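(* If $(M,\phi,\xi,\eta,g)$ is an almost cosymplectic $(\kappa,\mu,\nu)$-space of dimension greater than or equal to $5$ and $\kappa<0$, then its Riemannian curvature tensor can be written as $$R=-\kappa R_3-R_{5,2}-\mu R_6-\nu R_8 .$$
   Context: Manifolds, tensor fields and functions are smooth. An almost contact metric manifold $(M,\phi,\xi,\eta,g)$ is an odd-dimensional Riemannian manifold $(M,g)$ with a $(1,1)$-tensor field $\phi$, a vector field $\xi$ and a 1-form $\eta$ such that $\eta(\xi)=1$, $\phi^2X=-X+\eta(X)\xi$ and $g(\phi X,\phi Y)=g(X,Y)-\eta(X)\eta(Y)$. Its fundamental 2-form is $\Phi(X,Y)=g(X,\phi Y)$. It is almost cosymplectic if $d\eta=0$ and $d\Phi=0$. Put $h=\frac12L_\xi\phi$ ($L$ the Lie derivative) and $R(X,Y)Z=\nabla_X\nabla_YZ-\nabla_Y\nabla_XZ-\nabla_{[X,Y]}Z$, with $\nabla$ the Levi-Civita connection. A $(\kappa,\mu,\nu)$-space is an almost contact metric manifold satisfying, for some smooth functions $\kappa,\mu,\nu$ on $M$ and all $X,Y$, $$R(X,Y)\xi=\kappa\{\eta(Y)X-\eta(X)Y\}+\mu\{\eta(Y)hX-\eta(X)hY\}+\nu\{\eta(Y)\phi hX-\eta(X)\phi hY\}.$$ The tensors are, for all vector fields $X,Y,Z$: $R_3(X,Y)Z=\eta(X)\eta(Z)Y-\eta(Y)\eta(Z)X+g(X,Z)\eta(Y)\xi-g(Y,Z)\eta(X)\xi$; $R_{5,2}(X,Y)Z=g(\phi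 hY,Z)\phi hX-g(\phi hX,Z)\phi hY$; $R_6(X,Y)Z=\eta(X)\eta(Z)hY-\eta(Y)\eta(Z)hX+g(hX,Z)\eta(Y)\xi-g(hY,Z)\eta(X)\xi$; $R_8(X,Y)Z=\eta(X)\eta(Z)\phi hY-\eta(Y)\eta(Z)\phi hX+g(\phi hX,Z)\eta(Y)\xi-g(\phi hY,Z)\eta(X)\xi$. *)

theory Defs
  imports "HOL-Analysis.Analysis" "HOL-Library.Function_Algebras"
begin

section \<open>Smooth manifolds\<close>

text \<open>On an open subset of a Euclidean space, \<open>smooth_on\<close> is the class $C^\infty$: all iterated
  directional derivatives exist and are continuous.\<close>

primrec higher_differentiable_on ::
  "'e::euclidean_space set \<Rightarrow> ('e \<Rightarrow> 'b::real_normed_vector) \<Rightarrow> nat \<Rightarrow> bool" where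
  "higher_differentiable_on S f 0 \<longleftrightarrow> continuous_on S f"
| "higher_differentiable_on S f (Suc n) \<longleftrightarrow>
     (\<forall>x\<in>S. f differentiable (at x)) \<and>
     (\<forall>v. higher_differentiable_on S (\<lambda>x. frechet_derivative f (at x) v) n)"

definition smooth_on :: "'e::euclidean_space set \<Rightarrow> ('e \<Rightarrow> 'b::real_normed_vector) \<Rightarrow> bool" where
  "smooth_on S f \<longleftrightarrow> (\<forall>n. higher_differentiable_on S f n)"

text \<open>The underlying space of a manifold is a whole type, which is Hausdorff and second countable by
  its type classes. The dimension of the manifold is \<open>DIM('e)\<close>. An atlas need not be
  maximal.\<close>

type_synonym ('a, 'e) atlas = "('a set \<times> ('a \<Rightarrow> 'e)) set"

definition smooth_manifold ::
  "('a::{t2_space,second_countable_topology}, 'e::euclidean_space) atlas \<Rightarrow> bool" where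
  "smooth_manifold A \<longleftrightarrow>
     (\<Union>(U, c)\<in>A. U) = UNIV \<and>
     (\<forall>(U, c)\<in>A. open U \<and> open (c ` U) \<and> homeomorphism U (c ` U) c (inv_into U c)) \<and>
     (\<forall>(U, c)\<in>A. \<forall>(V, d)\<in>A. smooth_on (c ` (U \<inter> V)) (d \<circ> inv_into U c))"

definition smooth_fun ::
  "('a::{t2_space,second_countable_topology}, 'e::euclidean_space) atlas \<Rightarrow> ('a \<Rightarrow> real) \<Rightarrow> bool" where
  "smooth_fun A f \<longleftrightarrow> (\<forall>(U, c)\<in>A. smooth_on (c ` U) (f \<circ> inv_into U c))"

text \<open>Tangent vectors at \<open>p\<close> are the derivations at \<open>p\<close> of the algebra of smooth functions. HOL
  functions being total, they are made to vanish on non-smooth functions, so that equality of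
  tangent vectors is equality in HOL.\<close>

definition tangent_space ::
  "('a::{t2_space,second_countable_topology}, 'e::euclidean_space) atlas \<Rightarrow> 'a \<Rightarrow> (('a \<Rightarrow> real) \<Rightarrow> real) set"
  where
  "tangent_space A p = {v.
     (\<forall>f. \<not> smooth_fun A f \<longrightarrow> v f = 0) \<and>
     (\<forall>f g. smooth_fun A f \<longrightarrow> smooth_fun A g \<longrightarrow> v (f + g) = v f + v g) \<and>
     (\<forall>a f. smooth_fun A f \<longrightarrow> v (\<lambda>x. a * f x) = a * v f) \<and>
     (\<forall>f g. smooth_fun A f \<longrightarrow> smooth_fun A g \<longrightarrow> v (f * g) = f p * v g + g p * v f)}"

type_synonym 'a vfield = "'a \<Rightarrow> ('a \<Rightarrow> real) \<Rightarrow> real"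

definition deriv_along :: "'a vfield \<Rightarrow> ('a \<Rightarrow> real) \<Rightarrow> 'a \<Rightarrow> real" where
  "deriv_along X f = (\<lambda>p. X p f)"

definition vector_field ::
  "('a::{t2_space,second_countable_topology}, 'e::euclidean_space) atlas \<Rightarrow> 'a vfield \<Rightarrow> bool" where
  "vector_field A X \<longleftrightarrow>
     (\<forall>p. X p \<in> tangent_space A p) \<and> (\<forall>f. smooth_fun A f \<longrightarrow> smooth_fun A (deriv_along X f))"

text \<open>Functions and vector fields are added and multiplied pointwise by the instances of
  \<open>Function_Algebras\<close>; multiplication of a vector field by a function is:\<close>

definition fscale :: "('a \<Rightarrow> real) \<Rightarrow> 'a vfield \<Rightarrow> 'a vfield" (infixr "\<odot>" 75) where
  "u \<odot> X = (\<lambda>p f. u p * X p f)"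

definition lie_bracket :: "'a vfield \<Rightarrow> 'a vfield \<Rightarrow> 'a vfield" where
  "lie_bracket X Y = (\<lambda>p f. X p (deriv_along Y f) - Y p (deriv_along X f))"


section \<open>Tensor fields\<close>

text \<open>Tensor fields are maps on vector fields that are multilinear over the smooth functions. Their
  values on arguments that are not vector fields are irrelevant.\<close>

definition one_form ::
  "('a::{t2_space,second_countable_topology}, 'e::euclidean_space) atlas \<Rightarrow>
   ('a vfield \<Rightarrow> 'a \<Rightarrow> real) \<Rightarrow> bool" where
  "one_form A \<omega> \<longleftrightarrow>
     (\<forall>X. vector_field A X \<longrightarrow> smooth_fun A (\<omega> X)) \<and>
     (\<forall>X Y. vector_field A X \<longrightarrow> vector_field A Y \<longrightarrow> \<omega> (X + Y) = \<omega> X + \<omega> Y) \<and>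
     (\<forall>u X. smooth_fun A u \<longrightarrow> vector_field A X \<longrightarrow> \<omega> (u \<odot> X) = u * \<omega> X)"

definition tensor11 ::
  "('a::{t2_space,second_countable_topology}, 'e::euclidean_space) atlas \<Rightarrow>
   ('a vfield \<Rightarrow> 'a vfield) \<Rightarrow> bool" where
  "tensor11 A T \<longleftrightarrow>
     (\<forall>X. vector_field A X \<longrightarrow> vector_field A (T X)) \<and>
     (\<forall>X Y. vector_field A X \<longrightarrow> vector_field A Y \<longrightarrow> T (X + Y) = T X + T Y) \<and>
     (\<forall>u X. smooth_fun A u \<longrightarrow> vector_field A X \<longrightarrow> T (u \<odot> X) = u \<odot> T X)"

text \<open>Given symmetry, linearity in the second argument suffices. Every tangent vector extends to a
  vector field, so the last clause is positive definiteness on each tangent space.\<close>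

definition riemannian_metric ::
  "('a::{t2_space,second_countable_topology}, 'e::euclidean_space) atlas \<Rightarrow>
   ('a vfield \<Rightarrow> 'a vfield \<Rightarrow> 'a \<Rightarrow> real) \<Rightarrow> bool" where
  "riemannian_metric A g \<longleftrightarrow>
     (\<forall>X. vector_field A X \<longrightarrow> one_form A (g X)) \<and>
     (\<forall>X Y. vector_field A X \<longrightarrow> vector_field A Y \<longrightarrow> g X Y = g Y X) \<and>
     (\<forall>X p. vector_field A X \<longrightarrow> X p \<noteq> 0 \<longrightarrow> g X X p > 0)"

text \<open>The exterior derivatives of a 1-form and of a 2-form, without normalising factors; only their
  vanishing is used below.\<close>

definition ext_deriv1 ::
  "('a vfield \<Rightarrow> 'a \<Rightarrow> real) \<Rightarrow> 'a vfield \<Rightarrow> 'a vfield \<Rightarrow> 'a \<Rightarrow> real" where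
  "ext_deriv1 \<omega> X Y =
     deriv_along X (\<omega> Y) - deriv_along Y (\<omega> X) - \<omega> (lie_bracket X Y)"

definition ext_deriv2 ::
  "('a vfield \<Rightarrow> 'a vfield \<Rightarrow> 'a \<Rightarrow> real) \<Rightarrow> 'a vfield \<Rightarrow> 'a vfield \<Rightarrow> 'a vfield \<Rightarrow> 'a \<Rightarrow> real" where
  "ext_deriv2 \<Omega> X Y Z =
     deriv_along X (\<Omega> Y Z) + deriv_along Y (\<Omega> Z X) + deriv_along Z (\<Omega> X Y)
     - \<Omega> (lie_bracket X Y) Z - \<Omega> (lie_bracket Y Z) X - \<Omega> (lie_bracket Z X) Y"

definition lie_deriv11 ::
  "'a vfield \<Rightarrow> ('a vfield \<Rightarrow> 'a vfield) \<Rightarrow> 'a vfield \<Rightarrow> 'a vfield" where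
  "lie_deriv11 V T X = lie_bracket V (T X) - T (lie_bracket V X)"


section \<open>Levi-Civita connection and curvature\<close>

definition affine_connection ::
  "('a::{t2_space,second_countable_topology}, 'e::euclidean_space) atlas \<Rightarrow>
   ('a vfield \<Rightarrow> 'a vfield \<Rightarrow> 'a vfield) \<Rightarrow> bool" where
  "affine_connection A nab \<longleftrightarrow>
     (\<forall>Y. vector_field A Y \<longrightarrow> tensor11 A (\<lambda>X. nab X Y)) \<and>
     (\<forall>X Y Z. vector_field A X \<longrightarrow> vector_field A Y \<longrightarrow> vector_field A Z \<longrightarrow>
        nab X (Y + Z) = nab X Y + nab X Z) \<and>
     (\<forall>u X Y. smooth_fun A u \<longrightarrow> vector_field A X \<longrightarrow> vector_field A Y \<longrightarrow>
        nab X (u \<odot> Y) = deriv_along X u \<odot> Y + u \<odot> nab X Y)"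

definition levi_civita ::
  "('a::{t2_space,second_countable_topology}, 'e::euclidean_space) atlas \<Rightarrow>
   ('a vfield \<Rightarrow> 'a vfield \<Rightarrow> 'a \<Rightarrow> real) \<Rightarrow> ('a vfield \<Rightarrow> 'a vfield \<Rightarrow> 'a vfield) \<Rightarrow> bool" where
  "levi_civita A g nab \<longleftrightarrow>
     affine_connection A nab \<and>
     (\<forall>X Y. vector_field A X \<longrightarrow> vector_field A Y \<longrightarrow> nab X Y - nab Y X = lie_bracket X Y) \<and>
     (\<forall>X Y Z. vector_field A X \<longrightarrow> vector_field A Y \<longrightarrow> vector_field A Z \<longrightarrow>
        deriv_along X (g Y Z) = g (nab X Y) Z + g Y (nab X Z))"

definition curvature ::
  "('a vfield \<Rightarrow> 'a vfield \<Rightarrow> 'a vfield) \<Rightarrow> 'a vfield \<Rightarrow> 'a vfield \<Rightarrow> 'a vfield \<Rightarrow> 'a vfield" where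
  "curvature nab X Y Z =
     nab X (nab Y Z) - nab Y (nab X Z) - nab (lie_bracket X Y) Z"


section \<open>Almost contact metric structures\<close>

definition almost_contact_metric ::
  "('a::{t2_space,second_countable_topology}, 'e::euclidean_space) atlas \<Rightarrow>
   ('a vfield \<Rightarrow> 'a vfield) \<Rightarrow> 'a vfield \<Rightarrow> ('a vfield \<Rightarrow> 'a \<Rightarrow> real) \<Rightarrow>
   ('a vfield \<Rightarrow> 'a vfield \<Rightarrow> 'a \<Rightarrow> real) \<Rightarrow> bool" where
  "almost_contact_metric A \<phi> \<xi> \<eta> g \<longleftrightarrow>
     smooth_manifold A \<and> odd DIM('e) \<and> riemannian_metric A g \<and>
     tensor11 A \<phi> \<and> vector_field A \<xi> \<and> one_form A \<eta> \<and>
     \<eta> \<xi> = 1 \<and>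
     (\<forall>X. vector_field A X \<longrightarrow> \<phi> (\<phi> X) = - X + \<eta> X \<odot> \<xi>) \<and>
     (\<forall>X Y. vector_field A X \<longrightarrow> vector_field A Y \<longrightarrow> g (\<phi> X) (\<phi> Y) = g X Y - \<eta> X * \<eta> Y)"

definition fundamental_form ::
  "('a vfield \<Rightarrow> 'a vfield) \<Rightarrow> ('a vfield \<Rightarrow> 'a vfield \<Rightarrow> 'a \<Rightarrow> real) \<Rightarrow>
   'a vfield \<Rightarrow> 'a vfield \<Rightarrow> 'a \<Rightarrow> real" where
  "fundamental_form \<phi> g X Y = g X (\<phi> Y)"

definition almost_cosymplectic ::
  "('a::{t2_space,second_countable_topology}, 'e::euclidean_space) atlas \<Rightarrow>
   ('a vfield \<Rightarrow> 'a vfield) \<Rightarrow> 'a vfield \<Rightarrow> ('a vfield \<Rightarrow> 'a \<Rightarrow> real) \<Rightarrow>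
   ('a vfield \<Rightarrow> 'a vfield \<Rightarrow> 'a \<Rightarrow> real) \<Rightarrow> bool" where
  "almost_cosymplectic A \<phi> \<xi> \<eta> g \<longleftrightarrow>
     almost_contact_metric A \<phi> \<xi> \<eta> g \<and>
     (\<forall>X Y. vector_field A X \<longrightarrow> vector_field A Y \<longrightarrow> ext_deriv1 \<eta> X Y = 0) \<and>
     (\<forall>X Y Z. vector_field A X \<longrightarrow> vector_field A Y \<longrightarrow> vector_field A Z \<longrightarrow>
        ext_deriv2 (fundamental_form \<phi> g) X Y Z = 0)"

definition h_tensor :: "('a vfield \<Rightarrow> 'a vfield) \<Rightarrow> 'a vfield \<Rightarrow> 'a vfield \<Rightarrow> 'a vfield" where
  "h_tensor \<phi> \<xi> X = (\<lambda>_. 1/2) \<odot> lie_deriv11 \<xi> \<phi> X"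

definition kappa_mu_nu_space ::
  "('a::{t2_space,second_countable_topology}, 'e::euclidean_space) atlas \<Rightarrow>
   ('a vfield \<Rightarrow> 'a vfield) \<Rightarrow> 'a vfield \<Rightarrow> ('a vfield \<Rightarrow> 'a \<Rightarrow> real) \<Rightarrow>
   ('a vfield \<Rightarrow> 'a vfield \<Rightarrow> 'a \<Rightarrow> real) \<Rightarrow> ('a vfield \<Rightarrow> 'a vfield \<Rightarrow> 'a vfield) \<Rightarrow>
   ('a \<Rightarrow> real) \<Rightarrow> ('a \<Rightarrow> real) \<Rightarrow> ('a \<Rightarrow> real) \<Rightarrow> bool" where
  "kappa_mu_nu_space A \<phi> \<xi> \<eta> g nab \<kappa> \<mu> \<nu> \<longleftrightarrow>
     almost_contact_metric A \<phi> \<xi> \<eta> g \<and> levi_civita A g nab \<and>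
     smooth_fun A \<kappa> \<and> smooth_fun A \<mu> \<and> smooth_fun A \<nu> \<and>
     (\<forall>X Y. vector_field A X \<longrightarrow> vector_field A Y \<longrightarrow>
        (let h = h_tensor \<phi> \<xi> in
         curvature nab X Y \<xi> =
           \<kappa> \<odot> (\<eta> Y \<odot> X - \<eta> X \<odot> Y)
           + \<mu> \<odot> (\<eta> Y \<odot> h X - \<eta> X \<odot> h Y)
           + \<nu> \<odot> (\<eta> Y \<odot> \<phi> (h X) - \<eta> X \<odot> \<phi> (h Y))))"

definition R3 ::
  "'a vfield \<Rightarrow> ('a vfield \<Rightarrow> 'a \<Rightarrow> real) \<Rightarrow> ('a vfield \<Rightarrow> 'a vfield \<Rightarrow> 'a \<Rightarrow> real) \<Rightarrow>
   'a vfield \<Rightarrow> 'a vfield \<Rightarrow> 'a vfield \<Rightarrow> 'a vfield" where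
  "R3 \<xi> \<eta> g X Y Z =
     (\<eta> X * \<eta> Z) \<odot> Y - (\<eta> Y * \<eta> Z) \<odot> X + (g X Z * \<eta> Y) \<odot> \<xi> - (g Y Z * \<eta> X) \<odot> \<xi>"

definition R52 ::
  "('a vfield \<Rightarrow> 'a vfield) \<Rightarrow> 'a vfield \<Rightarrow> ('a vfield \<Rightarrow> 'a vfield \<Rightarrow> 'a \<Rightarrow> real) \<Rightarrow>
   'a vfield \<Rightarrow> 'a vfield \<Rightarrow> 'a vfield \<Rightarrow> 'a vfield" where
  "R52 \<phi> \<xi> g X Y Z =
     (let h = h_tensor \<phi> \<xi> in
      g (\<phi> (h Y)) Z \<odot> \<phi> (h X) - g (\<phi> (h X)) Z \<odot> \<phi> (h Y))"

definition R6 ::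
  "('a vfield \<Rightarrow> 'a vfield) \<Rightarrow> 'a vfield \<Rightarrow> ('a vfield \<Rightarrow> 'a \<Rightarrow> real) \<Rightarrow>
   ('a vfield \<Rightarrow> 'a vfield \<Rightarrow> 'a \<Rightarrow> real) \<Rightarrow>
   'a vfield \<Rightarrow> 'a vfield \<Rightarrow> 'a vfield \<Rightarrow> 'a vfield" where
  "R6 \<phi> \<xi> \<eta> g X Y Z =
     (let h = h_tensor \<phi> \<xi> in
      (\<eta> X * \<eta> Z) \<odot> h Y - (\<eta> Y * \<eta> Z) \<odot> h X
      + (g (h X) Z * \<eta> Y) \<odot> \<xi> - (g (h Y) Z * \<eta> X) \<odot> \<xi>)"

definition R8 ::
  "('a vfield \<Rightarrow> 'a vfield) \<Rightarrow> 'a vfield \<Rightarrow> ('a vfield \<Rightarrow> 'a \<Rightarrow> real) \<Rightarrow>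
   ('a vfield \<Rightarrow> 'a vfield \<Rightarrow> 'a \<Rightarrow> real) \<Rightarrow>
   'a vfield \<Rightarrow> 'a vfield \<Rightarrow> 'a vfield \<Rightarrow> 'a vfield" where
  "R8 \<phi> \<xi> \<eta> g X Y Z =
     (let h = h_tensor \<phi> \<xi> in
      (\<eta> X * \<eta> Z) \<odot> \<phi> (h Y) - (\<eta> Y * \<eta> Z) \<odot> \<phi> (h X)
      + (g (\<phi> (h X)) Z * \<eta> Y) \<odot> \<xi> - (g (\<phi> (h Y)) Z * \<eta> X) \<odot> \<xi>)"

end

theory Submission
  imports Defs
begin

text \<open>
  Let \<open>A = - \<nabla>\<xi>\<close> be the shape operator of the leaves of \<open>D = ker \<eta>\<close>, which is integrable since
  \<open>d\<eta> = 0\<close>; in the formal text this operator is called \<open>shape\<close>, as the letter denotes the atlas there.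
  The idea is that the leaves are flat: the Gauss equation then gives \<open>- R\<^bsub>5,2\<^esub>\<close> for the curvature
  on \<open>D\<close>, and the arguments in direction \<open>\<xi>\<close> are governed by the \<open>(\<kappa>,\<mu>,\<nu>)\<close>-condition, which
  prescribes \<open>R(X,Y)\<xi>\<close>.

  Closedness of \<open>\<eta>\<close> and \<open>\<Phi>\<close> makes \<open>A\<close> symmetric and gives \<open>\<nabla>\<^bsub>\<xi>\<^esub>\<phi> = 0\<close>,
  \<open>A\<phi> = - \<phi>A\<close>, \<open>h = - \<phi>A\<close> and \<open>\<phi>h = A\<close>. The part of \<open>R(X,\<xi>)\<xi>\<close> that commutes with
  \<open>\<phi>\<close> yields \<open>A\<^sup>2 = - \<kappa>\<close> on \<open>D\<close> (lemma \<open>shape_shape\<close>). So for \<open>\<kappa> < 0\<close> the operator \<open>A\<close> splits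
  \<open>D\<close> into two eigenbundles of equal rank that \<open>\<phi>\<close> interchanges.

  On the leaves the remaining input is \<open>R(X,Y)\<xi> = 0\<close> for horizontal \<open>X, Y\<close>, that is, the Codazzi
  equation. With the derivative of \<open>A\<^sup>2 = - \<kappa>\<close> it expresses the leafwise derivative of \<open>A\<close> through
  \<open>d\<kappa>\<close> and forces a linear identity on \<open>d\<kappa>\<close> (lemma \<open>dkappa_identity\<close>). In dimension at least five,
  when the eigenbundles have rank at least two, this identity leaves only \<open>d\<kappa> = 0\<close> on \<open>D\<close>
  (lemma \<open>dkappa_horizontal\<close>). Hence \<open>A\<close> is parallel along the leaves. Since \<open>\<Phi>\<close> is closed, \<open>\<phi>\<close> is
  then parallel as well (lemma \<open>kaehler_algebra\<close>): each leaf is Kaehler, with two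
  complementary parallel Lagrangian distributions. The curvature of such a leaf vanishes
  (lemma \<open>curvature_algebra_zero\<close>): by the product structure it can only be nonzero on four arguments
  from one eigenbundle, but it commutes with \<open>\<phi>\<close>, which interchanges the two.

  The three algebraic arguments avoid the eigenbundles, whose sections involve the square root
  of \<open>- \<kappa>\<close>; they use only polynomial identities in \<open>A\<close> and \<open>\<phi>\<close>. Leaves do not appear as
  manifolds either: their Levi-Civita connections are all restrictions of one metric
  connection on \<open>M\<close> for which \<open>\<xi>\<close> is parallel.

  The dimension enters through the existence of sufficiently many global vector fields, which is
  obtained from bump functions in a chart (lemma \<open>coordinate_frame\<close>).
\<close>

section \<open>Calculus of iterated derivatives\<close>

lemma higher_differentiable_on_cong:
  assumes "open S" "\<And>x. x \<in> S \<Longrightarrow> f x = g x"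
  shows "higher_differentiable_on S f n \<longleftrightarrow> higher_differentiable_on S g n"
proof -
  have imp: "higher_differentiable_on S f n \<Longrightarrow> higher_differentiable_on S g n"
    if "\<And>x. x \<in> S \<Longrightarrow> f x = g x" for f g :: "'a \<Rightarrow> 'b"
    using that
  proof (induction n arbitrary: f g)
    case 0
    then show ?case by (simp cong: continuous_on_cong)
  next
    case (Suc n)
    have d: "(g has_derivative frechet_derivative f (at x)) (at x)" if "x \<in> S" for x
    proof -
      have "(f has_derivative frechet_derivative f (at x)) (at x)"
        using Suc.prems(1) that by (simp add: frechet_derivative_works)
      then show ?thesis
        by (rule has_derivative_transform_within_open[OF _ assms(1) that]) (simp add: Suc.prems)
    qed
    then have e: "frechet_derivative g (at x) = frechet_derivative f (at x)" if "x \<in> S" for x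
      using that by (metis frechet_derivative_at)
    have "higher_differentiable_on S (\<lambda>x. frechet_derivative g (at x) v) n" for v
      by (rule Suc.IH[of "\<lambda>x. frechet_derivative f (at x) v"])
         (use Suc.prems(1) e in auto)
    then show ?case
      using d by (auto simp: differentiable_def)
  qed
  show ?thesis
    using imp[of f g, OF assms(2)] imp[of g f, OF assms(2)[symmetric]] by blast
qed

text \<open>The recursive definition refers to \<open>frechet_derivative\<close>; this introduction rule allows any explicit
  formula for the derivative on the open set instead.\<close>

lemma higher_differentiable_on_SucI:
  assumes "open S"
    and d: "\<And>x. x \<in> S \<Longrightarrow> (f has_derivative F x) (at x)"
    and n: "\<And>v. higher_differentiable_on S (\<lambda>x. F x v) n"
  shows "higher_differentiable_on S f (Suc n)"
proof -
  have "frechet_derivative f (at x) = F x" if "x \<in> S" for x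
    using frechet_derivative_at[OF d[OF that]] by simp
  then have "higher_differentiable_on S (\<lambda>x. frechet_derivative f (at x) v) n" for v
    by (subst higher_differentiable_on_cong[OF assms(1), of _ "\<lambda>x. F x v"]) (simp_all add: n)
  then show ?thesis
    using d by (auto simp: differentiable_def)
qed

lemma higher_differentiable_on_SucD:
  assumes "higher_differentiable_on S f (Suc n)" "x \<in> S"
  shows "(f has_derivative frechet_derivative f (at x)) (at x)"
  using assms by (simp add: frechet_derivative_works)

lemma higher_differentiable_on_lower:
  "higher_differentiable_on S f (Suc n) \<Longrightarrow> higher_differentiable_on S f n"
proof (induction n arbitrary: f)
  case 0
  then show ?case
    by (auto intro!: continuous_at_imp_continuous_on differentiable_imp_continuous_within)
next
  case (Suc n)
  have "higher_differentiable_on S (\<lambda>x. frechet_derivative f (at x) v) n" for v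
    by (rule Suc.IH) (use Suc.prems in simp)
  then show ?case
    using Suc.prems by simp
qed

lemma higher_differentiable_on_const: "open S \<Longrightarrow> higher_differentiable_on S (\<lambda>x. k) n"
proof (induction n arbitrary: k)
  case (Suc n)
  show ?case
    by (rule higher_differentiable_on_SucI[where F = "\<lambda>x v. 0"]) (use Suc in auto)
qed simp

lemma higher_differentiable_on_linear:
  assumes "bounded_linear L" "open S" "higher_differentiable_on S f n"
  shows "higher_differentiable_on S (\<lambda>x. L (f x)) n"
  using assms(3)
proof (induction n arbitrary: f)
  case 0
  then show ?case
    by (simp add: bounded_linear.continuous_on[OF assms(1)])
next
  case (Suc n)
  show ?case
    by (rule higher_differentiable_on_SucI[where F = "\<lambda>x v. L (frechet_derivative f (at x) v)"])
       (use Suc assms in \<open>auto simp: frechet_derivative_works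
          intro!: bounded_linear.has_derivative[OF assms(1)]\<close>)
qed

lemma higher_differentiable_on_id:
  assumes "open S"
  shows "higher_differentiable_on S (\<lambda>x. x) n"
proof (cases n)
  case (Suc m)
  show ?thesis
    unfolding Suc
    by (rule higher_differentiable_on_SucI[where F = "\<lambda>x v. v"])
       (use assms in \<open>auto intro: higher_differentiable_on_const\<close>)
qed simp

lemma higher_differentiable_on_add:
  assumes "open S" "higher_differentiable_on S f n" "higher_differentiable_on S g n"
  shows "higher_differentiable_on S (\<lambda>x. f x + g x) n"
  using assms(2,3)
proof (induction n arbitrary: f g)
  case 0
  then show ?case by (simp add: continuous_on_add)
next
  case (Suc n)
  show ?case
    by (rule higher_differentiable_on_SucI[where F = "\<lambda>x v. frechet_derivative f (at x) v +
          frechet_derivative g (at x) v"])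
       (use Suc assms in \<open>auto simp: frechet_derivative_works intro!: has_derivative_add\<close>)
qed

lemma higher_differentiable_on_mult:
  fixes f g :: "_ \<Rightarrow> real"
  assumes "open S" "higher_differentiable_on S f n" "higher_differentiable_on S g n"
  shows "higher_differentiable_on S (\<lambda>x. f x * g x) n"
  using assms(2,3)
proof (induction n arbitrary: f g)
  case 0
  then show ?case by (simp add: continuous_on_mult)
next
  case (Suc n)
  show ?case
  proof (rule higher_differentiable_on_SucI[where F = "\<lambda>x v. f x * frechet_derivative g (at x) v +
          frechet_derivative f (at x) v * g x"])
    fix x assume "x \<in> S"
    then show "((\<lambda>x. f x * g x) has_derivative (\<lambda>v. f x * frechet_derivative g (at x) v +
          frechet_derivative f (at x) v * g x)) (at x)"
      using Suc.prems by (intro has_derivative_mult) (auto simp: frechet_derivative_works)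
  next
    fix v
    show "higher_differentiable_on S (\<lambda>x. f x * frechet_derivative g (at x) v +
          frechet_derivative f (at x) v * g x) n"
      using Suc.prems Suc.prems[THEN higher_differentiable_on_lower] assms(1)
      by (intro higher_differentiable_on_add Suc.IH) auto
  qed (fact assms)
qed

lemma higher_differentiable_on_sum:
  assumes "open S" "\<And>i. i \<in> I \<Longrightarrow> higher_differentiable_on S (f i) n"
  shows "higher_differentiable_on S (\<lambda>x. \<Sum>i\<in>I. f i x) n"
  using assms(2)
  by (induction I rule: infinite_finite_induct)
     (auto intro: higher_differentiable_on_const higher_differentiable_on_add assms(1))

text \<open>The chain rule in coordinates writes the derivative of \<open>f \<circ> g\<close> as a sum of products of
  derivatives of \<open>g\<close> with partial derivatives of \<open>f\<close> composed with \<open>g\<close>. The latter are again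
  compositions of lower order, so induction on the order applies.\<close>

lemma higher_differentiable_on_compose:
  fixes f :: "'e::euclidean_space \<Rightarrow> real" and g :: "'d::euclidean_space \<Rightarrow> 'e"
  assumes "open S" "open T" "g ` S \<subseteq> T"
    and "higher_differentiable_on T f n" "higher_differentiable_on S g n"
  shows "higher_differentiable_on S (\<lambda>x. f (g x)) n"
  using assms(4,5)
proof (induction n arbitrary: f)
  case 0
  then show ?case
    using continuous_on_compose2 assms(3) by auto
next
  case (Suc n)
  define F where "F x v = (\<Sum>b\<in>Basis. (frechet_derivative g (at x) v \<bullet> b) *
      frechet_derivative f (at (g x)) b)" for x v
  show ?case
  proof (rule higher_differentiable_on_SucI[where F = F])
    fix x assume x: "x \<in> S"
    have df: "(f has_derivative frechet_derivative f (at (g x))) (at (g x))"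
      by (rule higher_differentiable_on_SucD[OF Suc.prems(1)]) (use x assms(3) in auto)
    have dg: "(g has_derivative frechet_derivative g (at x)) (at x)"
      by (rule higher_differentiable_on_SucD[OF Suc.prems(2) x])
    have "F x = frechet_derivative f (at (g x)) \<circ> frechet_derivative g (at x)"
    proof
      fix v
      let ?w = "frechet_derivative g (at x) v"
      have "frechet_derivative f (at (g x)) (\<Sum>b\<in>Basis. (?w \<bullet> b) *\<^sub>R b) = F x v"
        unfolding F_def linear_sum[OF has_derivative_linear[OF df]]
          linear_scale[OF has_derivative_linear[OF df]] by simp
      then show "F x v = (frechet_derivative f (at (g x)) \<circ> frechet_derivative g (at x)) v"
        by (simp add: euclidean_representation)
    qed
    then show "((\<lambda>x. f (g x)) has_derivative F x) (at x)"
      using diff_chain_at[OF dg df] by (simp add: o_def)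
  next
    fix v
    show "higher_differentiable_on S (\<lambda>x. F x v) n"
      unfolding F_def
    proof (intro higher_differentiable_on_sum higher_differentiable_on_mult assms(1))
      fix b :: 'e
      show "higher_differentiable_on S (\<lambda>x. frechet_derivative g (at x) v \<bullet> b) n"
        by (rule higher_differentiable_on_linear[OF bounded_linear_inner_left assms(1)])
           (use Suc.prems in simp)
      show "higher_differentiable_on S (\<lambda>x. frechet_derivative f (at (g x)) b) n"
        by (rule Suc.IH[OF _ higher_differentiable_on_lower[OF Suc.prems(2)]])
           (use Suc.prems(1) in simp)
    qed
  qed (fact assms)
qed

lemma higher_differentiable_on_subset:
  assumes "higher_differentiable_on T f n" "S \<subseteq> T"
  shows "higher_differentiable_on S f n"
  using assms(1)
  by (induction n arbitrary: f) (use assms(2) in \<open>auto intro: continuous_on_subset\<close>)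

lemma higher_differentiable_on_Un:
  assumes "open S" "open T" "higher_differentiable_on S f n" "higher_differentiable_on T f n"
  shows "higher_differentiable_on (S \<union> T) f n"
  using assms(3,4)
  by (induction n arbitrary: f) (use assms(1,2) in \<open>auto intro: continuous_on_open_Un\<close>)

section \<open>Bump functions\<close>

text \<open>The factor \<open>inverse t ^ k\<close> makes this family, which starts at the usual \<open>exp (- 1 / t)\<close>, closed under
  differentiation up to linear combinations.\<close>

definition flat :: "nat \<Rightarrow> real \<Rightarrow> real" where
  "flat k t = (if t > 0 then inverse t ^ k * exp (- inverse t) else 0)"

lemma flat_tendsto_0: "(flat k \<longlongrightarrow> 0) (at 0)"
proof -
  have "((\<lambda>t. inverse t ^ k / exp (inverse t)) \<longlongrightarrow> 0) (at_right (0::real))"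
    by (rule filterlim_compose[OF tendsto_power_div_exp_0 filterlim_inverse_at_top_right])
  then have "((\<lambda>t. flat k t) \<longlongrightarrow> 0) (at_right 0)"
  proof (rule Lim_transform_eventually)
    show "\<forall>\<^sub>F t in at_right 0. inverse t ^ k / exp (inverse t) = flat k t"
      using eventually_at_right_less[of 0]
      by eventually_elim (simp add: flat_def exp_minus divide_inverse)
  qed
  moreover have "((\<lambda>t. flat k t) \<longlongrightarrow> 0) (at_left 0)"
  proof (rule Lim_transform_eventually[OF tendsto_const])
    show "\<forall>\<^sub>F t in at_left 0. 0 = flat k t"
      by (rule eventually_at_leftI[of "-1"]) (auto simp: flat_def)
  qed
  ultimately show ?thesis
    by (simp add: filterlim_split_at)
qed

lemma flat_has_derivative:
  "(flat k has_field_derivative flat (k + 2) t - real k * flat (k + 1) t) (at t)"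
proof -
  consider "t > 0" | "t < 0" | "t = 0" by linarith
  then show ?thesis
  proof cases
    case 1
    let ?i = "inverse t"
    have p: "((\<lambda>t. inverse t ^ k) has_field_derivative - (real k * ?i ^ (k + 1))) (at t)"
    proof (cases k)
      case (Suc m)
      have "((\<lambda>t. inverse t ^ k) has_field_derivative
          real k * (- (?i ^ Suc (Suc 0)) * ?i ^ (k - Suc 0))) (at t)"
        using DERIV_power[OF DERIV_inverse[of t UNIV], of k] 1 by simp
      then show ?thesis by (simp add: Suc mult_ac)
    qed simp
    have e: "((\<lambda>t. exp (- inverse t)) has_field_derivative exp (- ?i) * ?i ^ 2) (at t)"
      using DERIV_fun_exp[OF DERIV_minus[OF DERIV_inverse[of t UNIV]]] 1
      by (simp add: power2_eq_square)
    have "((\<lambda>t. inverse t ^ k * exp (- inverse t)) has_field_derivative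
        flat (k + 2) t - real k * flat (k + 1) t) (at t)"
      using DERIV_mult[OF p e] 1 by (simp add: flat_def algebra_simps power_add power2_eq_square)
    then show ?thesis
    proof (rule has_field_derivative_transform_within_open)
      show "t \<in> {0<..}" using 1 by simp
    qed (auto simp: flat_def)
  next
    case 2
    have "((\<lambda>t. 0::real) has_field_derivative flat (k + 2) t - real k * flat (k + 1) t) (at t)"
      using 2 by (simp add: flat_def)
    then show ?thesis
    proof (rule has_field_derivative_transform_within_open)
      show "t \<in> {..<0}" using 2 by simp
    qed (auto simp: flat_def)
  next
    case 3
    \<comment> \<open>The difference quotient at \<open>0\<close> is the next member of the family.\<close>
    have "(\<lambda>h. (flat k (0 + h) - flat k 0) / h) = flat (Suc k)"
      by (auto simp: flat_def field_simps)
    then have "(flat k has_field_derivative 0) (at 0)"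
      using flat_tendsto_0[of "Suc k"] unfolding DERIV_def by simp
    then show ?thesis
      using 3 by (simp add: flat_def)
  qed
qed

lemma higher_differentiable_on_flat: "higher_differentiable_on UNIV (flat k) n"
proof (induction n arbitrary: k)
  case 0
  show ?case
    using flat_has_derivative by (auto intro!: DERIV_isCont continuous_at_imp_continuous_on)
next
  case (Suc n)
  show ?case
  proof (rule higher_differentiable_on_SucI[where F = "\<lambda>t v. (flat (k + 2) t + (- real k) * flat (k + 1) t) * v"])
    show "(flat k has_derivative (\<lambda>v. (flat (k + 2) t + (- real k) * flat (k + 1) t) * v)) (at t)" for t
      using flat_has_derivative[of k t] by (simp add: has_field_derivative_def)
    show "higher_differentiable_on UNIV (\<lambda>t. (flat (k + 2) t + (- real k) * flat (k + 1) t) * v) n" for v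
      by (intro higher_differentiable_on_mult higher_differentiable_on_add Suc
          higher_differentiable_on_const open_UNIV)
  qed simp
qed

definition bump :: "'e::euclidean_space \<Rightarrow> real \<Rightarrow> 'e \<Rightarrow> real" where
  "bump a r y = flat 0 (r\<^sup>2 - (y - a) \<bullet> (y - a))"

lemma bump_center: "r > 0 \<Longrightarrow> bump a r a > 0"
  by (simp add: bump_def flat_def)

lemma bump_outside:
  assumes "r > 0" "y \<notin> cball a r"
  shows "bump a r y = 0"
proof -
  have "r < norm (y - a)"
    using assms by (simp add: dist_norm norm_minus_commute)
  then have "r\<^sup>2 \<le> (norm (y - a))\<^sup>2"
    using assms by (intro power_mono) auto
  then show ?thesis
    by (simp add: bump_def flat_def power2_norm_eq_inner)
qed

lemma higher_differentiable_on_bump: "higher_differentiable_on UNIV (bump a r) n"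
proof -
  have diff: "higher_differentiable_on UNIV (\<lambda>y. (y - a) \<bullet> b) n" for b
    using higher_differentiable_on_linear[OF bounded_linear_inner_left open_UNIV
        higher_differentiable_on_add[OF open_UNIV higher_differentiable_on_id[OF open_UNIV]
          higher_differentiable_on_const[OF open_UNIV, of "- a"]]]
    by simp
  have "higher_differentiable_on UNIV
      (\<lambda>y. r\<^sup>2 + (-1) * (\<Sum>b\<in>Basis. ((y - a) \<bullet> b) * ((y - a) \<bullet> b))) n"
    by (intro higher_differentiable_on_add higher_differentiable_on_mult higher_differentiable_on_sum
        higher_differentiable_on_const diff open_UNIV)
  from higher_differentiable_on_compose[OF open_UNIV open_UNIV _ higher_differentiable_on_flat this]
  have "higher_differentiable_on UNIV
      (\<lambda>y. flat 0 (r\<^sup>2 + (-1) * (\<Sum>b\<in>Basis. ((y - a) \<bullet> b) * ((y - a) \<bullet> b)))) n"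
    by simp
  moreover have "bump a r = (\<lambda>y. flat 0 (r\<^sup>2 + (-1) * (\<Sum>b\<in>Basis. ((y - a) \<bullet> b) * ((y - a) \<bullet> b))))"
    unfolding bump_def euclidean_inner[of "y - a" "y - a" for y] by simp
  ultimately show ?thesis by simp
qed

section \<open>Smooth functions and vector fields\<close>

lemma fscale_add_right: "u \<odot> (X + Y) = u \<odot> X + u \<odot> Y"
  and fscale_diff_right: "u \<odot> (X - Y) = u \<odot> X - u \<odot> Y"
  and fscale_diff_left: "(u - v) \<odot> X = u \<odot> X - v \<odot> X"
  and fscale_minus_right: "u \<odot> (- X) = - (u \<odot> X)"
  and fscale_minus_left: "(- u) \<odot> X = - (u \<odot> X)"
  and fscale_fscale: "u \<odot> v \<odot> X = (u * v) \<odot> X"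
  and fscale_one: "1 \<odot> X = X"
  and fscale_zero_left: "0 \<odot> X = 0"
  and fscale_zero_right: "u \<odot> 0 = 0"
  by (auto simp: fscale_def fun_eq_iff algebra_simps)

lemma deriv_along_add_field: "deriv_along (X + Y) f = deriv_along X f + deriv_along Y f"
  and deriv_along_fscale: "deriv_along (u \<odot> X) f = u * deriv_along X f"
  by (auto simp: deriv_along_def fscale_def fun_eq_iff)

locale manifold =
  fixes A :: "('a::{t2_space,second_countable_topology}, 'e::euclidean_space) atlas"
  assumes manifold: "smooth_manifold A"
begin

abbreviation sf :: "('a \<Rightarrow> real) \<Rightarrow> bool" where
  "sf \<equiv> smooth_fun A"

abbreviation vf :: "'a vfield \<Rightarrow> bool" where
  "vf \<equiv> vector_field A"

lemma open_chart_image: "(U, c) \<in> A \<Longrightarrow> open (c ` U)"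
  using manifold by (auto simp: smooth_manifold_def)

lemma sfI:
  assumes "\<And>U c n. (U, c) \<in> A \<Longrightarrow> higher_differentiable_on (c ` U) (\<lambda>y. f (inv_into U c y)) n"
  shows "sf f"
  using assms by (auto simp: smooth_fun_def smooth_on_def o_def)

lemma sfD:
  "sf f \<Longrightarrow> (U, c) \<in> A \<Longrightarrow> higher_differentiable_on (c ` U) (\<lambda>y. f (inv_into U c y)) n"
  by (auto simp: smooth_fun_def smooth_on_def o_def)

lemma sf_const [simp, intro]: "sf (\<lambda>_. k)"
  by (intro sfI higher_differentiable_on_const open_chart_image)

lemma sf_add [simp, intro]:
  assumes "sf f" "sf g"
  shows "sf (f + g)"
proof (rule sfI)
  fix U c n
  assume Uc: "(U, c) \<in> A"
  show "higher_differentiable_on (c ` U) (\<lambda>y. (f + g) (inv_into U c y)) n"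
    using higher_differentiable_on_add[OF open_chart_image[OF Uc] sfD[OF assms(1) Uc] sfD[OF assms(2) Uc]]
    by simp
qed

lemma sf_mult [simp, intro]:
  assumes "sf f" "sf g"
  shows "sf (f * g)"
proof (rule sfI)
  fix U c n
  assume Uc: "(U, c) \<in> A"
  show "higher_differentiable_on (c ` U) (\<lambda>y. (f * g) (inv_into U c y)) n"
    using higher_differentiable_on_mult[OF open_chart_image[OF Uc] sfD[OF assms(1) Uc] sfD[OF assms(2) Uc]]
    by simp
qed

lemma sf_0 [simp, intro]: "sf 0" and sf_1 [simp, intro]: "sf 1"
  by (simp_all add: zero_fun_def one_fun_def)

lemma sf_uminus [simp, intro]: "sf f \<Longrightarrow> sf (- f)"
  using sf_mult[of "\<lambda>_. -1" f] by (simp add: times_fun_def fun_Compl_def)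

lemma sf_diff [simp, intro]: "sf f \<Longrightarrow> sf g \<Longrightarrow> sf (f - g)"
  using sf_add[of f "- g"] by simp

context
  fixes X
  assumes X: "vf X"
begin

lemma vf_nonsmooth: "\<not> sf f \<Longrightarrow> X p f = 0"
  and vf_add_fun: "sf f \<Longrightarrow> sf g \<Longrightarrow> X p (f + g) = X p f + X p g"
  and vf_scale_fun: "sf f \<Longrightarrow> X p (\<lambda>x. a * f x) = a * X p f"
  and vf_mult_fun: "sf f \<Longrightarrow> sf g \<Longrightarrow> X p (f * g) = f p * X p g + g p * X p f"
  using X by (auto simp: vector_field_def tangent_space_def)

text \<open>Leibniz for \<open>1 = 1 * 1\<close> forces derivations to kill constants.\<close>

lemma vf_const_fun [simp]: "X p (\<lambda>_. a) = 0"
proof -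
  have "X p 1 = 0"
    using vf_mult_fun[of 1 1 p] by simp
  then show ?thesis
    using vf_scale_fun[of 1 p a] by (simp add: one_fun_def)
qed

lemma vf_uminus_fun: "sf f \<Longrightarrow> X p (- f) = - X p f"
  using vf_scale_fun[of f p "-1"] by (simp add: fun_Compl_def)

lemma vf_diff_fun: "sf f \<Longrightarrow> sf g \<Longrightarrow> X p (f - g) = X p f - X p g"
  using vf_add_fun[of f "- g" p] vf_uminus_fun[of g p] by simp

text \<open>If \<open>f\<close> is not smooth, its derivative along a vector field is the zero function.\<close>

lemma sf_deriv_along [simp, intro]: "sf (deriv_along X f)"
proof (cases "sf f")
  case False
  then have "deriv_along X f = 0"
    by (auto simp: deriv_along_def vf_nonsmooth)
  then show ?thesis by simp
qed (use X in \<open>simp add: vector_field_def\<close>)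

lemma deriv_along_add: "sf f \<Longrightarrow> sf g \<Longrightarrow> deriv_along X (f + g) = deriv_along X f + deriv_along X g"
  and deriv_along_uminus: "sf f \<Longrightarrow> deriv_along X (- f) = - deriv_along X f"
  and deriv_along_const: "deriv_along X (\<lambda>_. k) = 0"
  by (auto simp: deriv_along_def fun_eq_iff vf_add_fun vf_diff_fun vf_uminus_fun vf_mult_fun)

lemma deriv_along_0: "deriv_along X 0 = 0" and deriv_along_1: "deriv_along X 1 = 0"
  using deriv_along_const by (simp_all add: zero_fun_def one_fun_def)

end

lemma vfI:
  assumes "\<And>p f. \<not> sf f \<Longrightarrow> X p f = 0"
    and "\<And>p f g. sf f \<Longrightarrow> sf g \<Longrightarrow> X p (f + g) = X p f + X p g"
    and "\<And>p a f. sf f \<Longrightarrow> X p (\<lambda>x. a * f x) = a * X p f"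
    and "\<And>p f g. sf f \<Longrightarrow> sf g \<Longrightarrow> X p (f * g) = f p * X p g + g p * X p f"
    and "\<And>f. sf f \<Longrightarrow> sf (deriv_along X f)"
  shows "vf X"
  using assms by (simp add: vector_field_def tangent_space_def)

lemma vf_add [simp, intro]: "vf X \<Longrightarrow> vf Y \<Longrightarrow> vf (X + Y)"
  by (rule vfI)
     (auto simp: vf_nonsmooth vf_add_fun vf_scale_fun vf_mult_fun algebra_simps deriv_along_add_field)

lemma vf_fscale [simp, intro]: "sf u \<Longrightarrow> vf X \<Longrightarrow> vf (u \<odot> X)"
proof (rule vfI, goal_cases)
  case 5
  then show ?case by (simp add: deriv_along_fscale)
qed (auto simp: vf_nonsmooth vf_add_fun vf_scale_fun vf_mult_fun algebra_simps fscale_def)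

lemma vf_0 [simp, intro]: "vf 0"
proof (rule vfI, goal_cases)
  case 5
  then show ?case by (simp add: deriv_along_def flip: zero_fun_def)
qed auto

lemma vf_uminus [simp, intro]: "vf X \<Longrightarrow> vf (- X)"
  using vf_fscale[of "- 1" X] by (simp add: fscale_minus_left fscale_one)

lemma vf_diff [simp, intro]: "vf X \<Longrightarrow> vf Y \<Longrightarrow> vf (X - Y)"
  using vf_add[of X "- Y"] by simp

lemma vf_sum [intro]: "(\<And>i. i \<in> I \<Longrightarrow> vf (X i)) \<Longrightarrow> vf (\<Sum>i\<in>I. X i)"
  by (induction I rule: infinite_finite_induct) auto

lemma deriv_along_lie_bracket:
  "deriv_along (lie_bracket X Y) f =
    deriv_along X (deriv_along Y f) - deriv_along Y (deriv_along X f)"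
  by (auto simp: deriv_along_def lie_bracket_def fun_eq_iff)

lemma jacobi_identity:
  assumes "vf X" "vf Y" "vf Z"
  shows "lie_bracket X (lie_bracket Y Z) + lie_bracket Y (lie_bracket Z X)
    + lie_bracket Z (lie_bracket X Y) = 0"
proof -
  have "lie_bracket X (lie_bracket Y Z) p f + lie_bracket Y (lie_bracket Z X) p f
    + lie_bracket Z (lie_bracket X Y) p f = 0" for p f
    unfolding lie_bracket_def[of _ "lie_bracket _ _"] deriv_along_lie_bracket
    using assms by (simp add: vf_diff_fun lie_bracket_def)
  then show ?thesis by (simp add: fun_eq_iff)
qed

section \<open>Global frames at a point\<close>

text \<open>In another chart the extension is the composition of \<open>G\<close> with a transition map on the part
  of the chart that meets \<open>U\<close>, and zero off the preimage \<open>K\<close> of the ball. The second part is open because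
  \<open>K\<close> is compact, hence closed in the Hausdorff space. The two parts cover the chart.\<close>

lemma sf_extend_by_zero:
  assumes chart: "(U, c) \<in> A"
    and ball: "cball a r \<subseteq> c ` U"
    and G: "\<And>n. higher_differentiable_on (c ` U) G n"
    and G0: "\<And>y. y \<in> c ` U \<Longrightarrow> y \<notin> cball a r \<Longrightarrow> G y = 0"
  shows "sf (\<lambda>q. if q \<in> U then G (c q) else 0)"
proof (rule sfI)
  fix V d n
  assume Vd: "(V, d) \<in> A"
  have hU: "homeomorphism U (c ` U) c (inv_into U c)" and hV: "homeomorphism V (d ` V) d (inv_into V d)"
    and oU: "open U" "open V"
    using manifold chart Vd by (auto simp: smooth_manifold_def)
  define K where "K = inv_into U c ` cball a r"
  have "continuous_on (cball a r) (inv_into U c)"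
    using hU ball by (auto simp: homeomorphism_def intro: continuous_on_subset)
  then have "compact K"
    unfolding K_def by (intro compact_continuous_image) auto
  then have "closed K"
    by (rule compact_imp_closed)
  have KU: "K \<subseteq> U"
    using ball inv_into_into[of _ c U] by (auto simp: K_def)
  have open_image: "open (d ` W)" if "open W" "W \<subseteq> V" for W
    using homeomorphism_imp_open_map[OF hV, of W] that open_chart_image[OF Vd]
    by (metis open_subset openin_open_trans)
  let ?f = "\<lambda>y. if inv_into V d y \<in> U then G (c (inv_into V d y)) else 0"
  have T1: "higher_differentiable_on (d ` (V \<inter> U)) ?f n"
  proof -
    have "smooth_on (d ` (V \<inter> U)) (c \<circ> inv_into V d)"
      using manifold chart Vd unfolding smooth_manifold_def by blast
    then have t: "higher_differentiable_on (d ` (V \<inter> U)) (\<lambda>y. c (inv_into V d y)) n"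
      by (simp add: smooth_on_def o_def)
    have "open (d ` (V \<inter> U))" "(\<lambda>y. c (inv_into V d y)) ` d ` (V \<inter> U) \<subseteq> c ` U"
      using open_image[of "V \<inter> U"] oU homeomorphism_apply1[OF hV] by auto
    then have "higher_differentiable_on (d ` (V \<inter> U)) (\<lambda>y. G (c (inv_into V d y))) n"
      using higher_differentiable_on_compose[OF _ open_chart_image[OF chart] _ G t] by blast
    then show ?thesis
      by (subst higher_differentiable_on_cong[where g = "\<lambda>y. G (c (inv_into V d y))"])
         (use open_image[of "V \<inter> U"] oU homeomorphism_apply1[OF hV] in auto)
  qed
  have oK: "open (d ` (V - K))"
    using open_image[of "V - K"] oU \<open>closed K\<close> by auto
  have T2: "higher_differentiable_on (d ` (V - K)) ?f n"
  proof (subst higher_differentiable_on_cong[OF oK, where g = "\<lambda>y. 0"])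
    fix y assume "y \<in> d ` (V - K)"
    then obtain q where q: "q \<in> V" "q \<notin> K" "y = d q" by auto
    have "G (c q) = 0" if "q \<in> U"
    proof (rule G0)
      show "c q \<notin> cball a r"
        using q that homeomorphism_apply1[OF hU that] by (metis K_def image_eqI)
    qed (use that in simp)
    then show "?f y = 0"
      using q homeomorphism_apply1[OF hV] by simp
  qed (use oK in \<open>rule higher_differentiable_on_const\<close>)
  have "d ` V = d ` (V \<inter> U) \<union> d ` (V - K)"
    using KU by auto
  then show "higher_differentiable_on (d ` V) (\<lambda>y. ?f y) n"
    using higher_differentiable_on_Un[OF _ oK T1 T2] open_image[of "V \<inter> U"] oU by auto
qed

text \<open>The coordinate fields and the coordinate functions of a chart become global after multiplication
  by a bump function. At the centre \<open>a\<close> the bump function contributes a factor \<open>bump a r a\<close> to the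
  fields and another one to the functions, as the coordinates \<open>y - a\<close> vanish there; the
  functions are normalised by the square.\<close>

lemma coordinate_frame:
  obtains f :: "'e \<Rightarrow> 'a \<Rightarrow> real" and X :: "'e \<Rightarrow> 'a vfield"
  where "\<And>b. vf (X b)"
    and "\<And>b b'. b \<in> Basis \<Longrightarrow> b' \<in> Basis \<Longrightarrow> X b p (f b') = (if b = b' then 1 else 0)"
proof -
  have "(\<Union>(U, c)\<in>A. U) = UNIV"
    using manifold unfolding smooth_manifold_def by (rule conjunct1)
  then have "p \<in> (\<Union>(U, c)\<in>A. U)"
    by (rule ssubst) (rule UNIV_I)
  then obtain U c where chart: "(U, c) \<in> A" and p: "p \<in> U"
    by auto
  have hU: "homeomorphism U (c ` U) c (inv_into U c)"
    using manifold chart by (auto simp: smooth_manifold_def)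
  have oc: "open (c ` U)" by (rule open_chart_image[OF chart])
  define a where "a = c p"
  obtain r where r: "r > 0" "cball a r \<subseteq> c ` U"
    using oc p open_contains_cball[of "c ` U"] by (auto simp: a_def)
  let ?\<psi> = "bump a r"
  have \<psi>: "higher_differentiable_on (c ` U) ?\<psi> n" for n
    by (rule higher_differentiable_on_subset[OF higher_differentiable_on_bump]) simp
  define D where "D h y = frechet_derivative (\<lambda>y. h (inv_into U c y)) (at y)" for h :: "'a \<Rightarrow> real" and y
  have D: "((\<lambda>y. h (inv_into U c y)) has_derivative D h (c q)) (at (c q))" if "sf h" "q \<in> U" for h q
    unfolding D_def
    by (rule higher_differentiable_on_SucD[OF sfD[OF that(1) chart]]) (use that in simp)
  have D_eq: "D h (c q) = D'" if "((\<lambda>y. h (inv_into U c y)) has_derivative D') (at (c q))" for h q D'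
    using frechet_derivative_at[OF that] by (simp add: D_def)
  define X where "X b q h = (if q \<in> U \<and> sf h then ?\<psi> (c q) * D h (c q) b else 0)" for b q h
  have vf: "vf (X b)" for b
  proof (rule vfI)
    fix q f g assume f: "sf f" and g: "sf g"
    show "X b q (f + g) = X b q f + X b q g"
    proof (cases "q \<in> U")
      case True
      have "D (f + g) (c q) = (\<lambda>v. D f (c q) v + D g (c q) v)"
        by (rule D_eq) (use has_derivative_add[OF D[OF f True] D[OF g True]] in simp)
      then show ?thesis
        using f g by (simp add: X_def algebra_simps)
    qed (simp add: X_def)
    show "X b q (f * g) = f q * X b q g + g q * X b q f"
    proof (cases "q \<in> U")
      case True
      have "D (f * g) (c q) = (\<lambda>v. f q * D g (c q) v + D f (c q) v * g q)"
        by (rule D_eq)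
           (use has_derivative_mult[OF D[OF f True] D[OF g True]] homeomorphism_apply1[OF hU True] in simp)
      then show ?thesis
        using f g by (simp add: X_def algebra_simps)
    qed (simp add: X_def)
  next
    fix q k f assume f: "sf f"
    have kf: "sf (\<lambda>x. k * f x)"
      using sf_mult[OF sf_const f, of k] by (simp add: times_fun_def)
    show "X b q (\<lambda>x. k * f x) = k * X b q f"
    proof (cases "q \<in> U")
      case True
      have "D (\<lambda>x. k * f x) (c q) = (\<lambda>v. k * D f (c q) v)"
        by (rule D_eq) (use has_derivative_mult_right[OF D[OF f True]] in simp)
      then show ?thesis
        using f kf by (simp add: X_def)
    qed (simp add: X_def)
  next
    fix f assume f: "sf f"
    have "sf (\<lambda>q. if q \<in> U then (\<lambda>y. ?\<psi> y * D f y b) (c q) else 0)"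
    proof (rule sf_extend_by_zero[OF chart r(2)])
      fix n
      have "higher_differentiable_on (c ` U) (\<lambda>y. D f y b) n"
        using sfD[OF f chart, of "Suc n"] by (simp add: D_def)
      then show "higher_differentiable_on (c ` U) (\<lambda>y. ?\<psi> y * D f y b) n"
        by (rule higher_differentiable_on_mult[OF oc \<psi>])
    qed (simp add: bump_outside r)
    moreover have "deriv_along (X b) f = (\<lambda>q. if q \<in> U then (\<lambda>y. ?\<psi> y * D f y b) (c q) else 0)"
      by (auto simp: deriv_along_def X_def f)
    ultimately show "sf (deriv_along (X b) f)" by simp
  qed (simp add: X_def)
  define G where "G b y = inverse ((?\<psi> a)\<^sup>2) * (?\<psi> y * ((y - a) \<bullet> b))" for b y
  define f where "f b q = (if q \<in> U then G b (c q) else 0)" for b q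
  have f: "sf (f b)" for b
    unfolding f_def
  proof (rule sf_extend_by_zero[OF chart r(2)])
    fix n
    have "higher_differentiable_on (c ` U) (\<lambda>y. (y - a) \<bullet> b) n"
      using higher_differentiable_on_linear[OF bounded_linear_inner_left oc
          higher_differentiable_on_add[OF oc higher_differentiable_on_id[OF oc]
            higher_differentiable_on_const[OF oc, of "- a"]]]
      by simp
    then show "higher_differentiable_on (c ` U) (G b) n"
      unfolding G_def
      by (intro higher_differentiable_on_mult higher_differentiable_on_const oc \<psi>)
  qed (simp add: G_def bump_outside r)
  have "X b p (f b') = b \<bullet> b'" for b b'
  proof -
    have "(?\<psi> has_derivative frechet_derivative ?\<psi> (at a)) (at a)"
      by (rule higher_differentiable_on_SucD[OF \<psi>]) (use p in \<open>simp add: a_def\<close>)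
    then have "(G b' has_derivative (\<lambda>v. inverse ((?\<psi> a)\<^sup>2) * (?\<psi> a * (v \<bullet> b')))) (at a)"
      unfolding G_def by (auto intro!: derivative_eq_intros)
    then have "((\<lambda>y. f b' (inv_into U c y)) has_derivative (\<lambda>v. inverse ((?\<psi> a)\<^sup>2) * (?\<psi> a * (v \<bullet> b')))) (at a)"
      by (rule has_derivative_transform_within_open[OF _ oc])
         (use p homeomorphism_apply1[OF hU] in \<open>auto simp: a_def f_def\<close>)
    then have "D (f b') (c p) = (\<lambda>v. inverse ((?\<psi> a)\<^sup>2) * (?\<psi> a * (v \<bullet> b')))"
      by (intro D_eq) (simp add: a_def)
    then have "X b p (f b') = ?\<psi> a * (inverse ((?\<psi> a)\<^sup>2) * (?\<psi> a * (b \<bullet> b')))"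
      using f p by (simp add: X_def a_def)
    then show ?thesis
      using bump_center[OF r(1), of a] by (simp add: power2_eq_square)
  qed
  then show ?thesis
    using that[of X f] vf by (simp add: inner_Basis)
qed

text \<open>By \<open>coordinate_frame\<close> the values of vector fields at \<open>p\<close> form a space of dimension at least
  \<open>DIM('e)\<close>, so fewer than \<open>DIM('e)\<close> linear conditions have a solution that does not
  vanish at \<open>p\<close>.\<close>

lemma exists_field_in_kernel:
  fixes l :: "nat \<Rightarrow> 'a vfield \<Rightarrow> real"
  assumes add: "\<And>i X Y. vf X \<Longrightarrow> vf Y \<Longrightarrow> l i (X + Y) = l i X + l i Y"
    and scale: "\<And>i k X. vf X \<Longrightarrow> l i ((\<lambda>_. k) \<odot> X) = k * l i X"
    and dim: "n < DIM('e)"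
  obtains X where "vf X" "X p \<noteq> 0" "\<And>i. i < n \<Longrightarrow> l i X = 0"
proof -
  obtain f and E :: "'e \<Rightarrow> 'a vfield" where E: "\<And>b. vf (E b)"
    and dual: "\<And>b b'. b \<in> Basis \<Longrightarrow> b' \<in> Basis \<Longrightarrow> E b p (f b') = (if b = b' then 1 else 0)"
    using coordinate_frame[of p] by metis
  obtain B :: "'e set" where B: "B \<subseteq> Basis" "card B = n"
    using dim by (metis obtain_subset_with_card_n less_imp_le)
  have "finite B" using B(1) finite_Basis finite_subset by blast
  then obtain e where e: "bij_betw e {..<n} B"
    using B(2) ex_bij_betw_nat_finite[of B] by (metis atLeast0LessThan)
  \<comment> \<open>The \<open>n\<close> functionals are collected in a linear map into the span of \<open>n\<close> basis vectors of \<open>'e\<close> itself.\<close>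
  define T where "T y = (\<Sum>i<n. (\<Sum>b\<in>Basis. (y \<bullet> b) * l i (E b)) *\<^sub>R e i)" for y :: 'e
  have lin: "linear T"
    by (rule linearI) (simp_all add: T_def inner_add_left scaleR_add_left sum.distrib
        distrib_right scaleR_right.sum sum_distrib_left mult.assoc)
  have "T y \<in> span B" for y
    unfolding T_def
    by (rule span_sum, rule span_scale, rule span_base) (use e in \<open>auto simp: bij_betw_def\<close>)
  then have "range T \<subseteq> span B"
    by auto
  then have "dim (range T) \<le> n"
    using dim_subset[of "range T" "span B"] dim_le_card'[OF \<open>finite B\<close>] B by (simp add: dim_span)
  then have "\<not> inj T"
    using dim_image_eq[OF lin, of UNIV] dim by auto
  then obtain y where y: "T y = 0" "y \<noteq> 0"
    using linear_injective_0[OF lin] by auto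
  define X where "X = (\<Sum>b\<in>Basis. (\<lambda>_. y \<bullet> b) \<odot> E b)"
  have "vf X"
    unfolding X_def using E by auto
  moreover have "X p \<noteq> 0"
  proof -
    obtain b where b: "b \<in> Basis" "y \<bullet> b \<noteq> 0"
      using y(2) euclidean_all_zero_iff by blast
    have "(\<Sum>b\<in>S. (\<lambda>_. y \<bullet> b) \<odot> E b) p h = (\<Sum>b\<in>S. (y \<bullet> b) * E b p h)" for S h
      by (induction S rule: infinite_finite_induct) (simp_all add: fscale_def)
    then have "X p h = (\<Sum>b\<in>Basis. (y \<bullet> b) * E b p h)" for h
      by (simp add: X_def)
    then have "X p (f b) = y \<bullet> b"
      using b dual by (simp add: if_distrib[of "(*) _"] cong: if_cong)
    then show ?thesis using b by auto
  qed
  moreover have "l i X = 0" if i: "i < n" for i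
  proof -
    have l0: "l i 0 = 0"
      using add[of 0 0 i] by simp
    have "l i (\<Sum>b\<in>S. (\<lambda>_. y \<bullet> b) \<odot> E b) = (\<Sum>b\<in>S. (y \<bullet> b) * l i (E b))" for S
    proof (induction S rule: infinite_finite_induct)
      case (insert b S)
      have "vf (\<Sum>b\<in>S. (\<lambda>_. y \<bullet> b) \<odot> E b)"
        using E by (intro vf_sum) simp
      from add[OF vf_fscale[OF sf_const E] this] show ?case
        by (simp only: sum.insert[OF insert.hyps] insert.IH scale[OF E])
    qed (simp_all only: sum.infinite sum.empty l0 not_False_eq_True)
    then have li: "l i X = (\<Sum>b\<in>Basis. (y \<bullet> b) * l i (E b))"
      by (simp add: X_def)
    have inj: "e j = e i \<longleftrightarrow> j = i" if "j < n" for j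
      using e i that by (auto simp: bij_betw_def inj_on_def)
    have eB: "e j \<in> Basis" if "j < n" for j
      using e that B by (auto simp: bij_betw_def)
    have "0 = T y \<bullet> e i" using y by simp
    also have "\<dots> = (\<Sum>j<n. (\<Sum>b\<in>Basis. (y \<bullet> b) * l j (E b)) * (if j = i then 1 else 0))"
      unfolding T_def inner_sum_left inner_scaleR_left
      by (intro sum.cong refl) (use eB i inj in \<open>auto simp: inner_Basis\<close>)
    also have "\<dots> = l i X"
      using i li by (simp add: if_distrib[of "(*) _"] cong: if_cong)
    finally show ?thesis by simp
  qed
  ultimately show ?thesis using that by blast
qed

end

section \<open>Algebra of curvature-like and torsion-like tensors\<close>

lemma pair_symmetry:
  fixes r :: "'v \<Rightarrow> 'v \<Rightarrow> 'v \<Rightarrow> 'v \<Rightarrow> real"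
  assumes s12: "\<And>x y z w. \<lbrakk>x \<in> H; y \<in> H; z \<in> H; w \<in> H\<rbrakk> \<Longrightarrow> r y x z w = - r x y z w"
    and s34: "\<And>x y z w. \<lbrakk>x \<in> H; y \<in> H; z \<in> H; w \<in> H\<rbrakk> \<Longrightarrow> r x y w z = - r x y z w"
    and bianchi: "\<And>x y z w. \<lbrakk>x \<in> H; y \<in> H; z \<in> H; w \<in> H\<rbrakk> \<Longrightarrow> r x y z w + r y z x w + r z x y w = 0"
    and H: "x \<in> H" "y \<in> H" "z \<in> H" "w \<in> H"
  shows "r x y z w = r z w x y"
  using bianchi[of x y z w] bianchi[of y z w x] bianchi[of z w x y] bianchi[of w x y z]
    s12[of x y z w] s12[of y z x w] s12[of z x y w] s12[of w x y z] s12[of y w z x] s12[of z w x y]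
    s34[of x y z w] s34[of y z x w] s34[of z x y w] s34[of w x y z] s34[of y w z x] s34[of z w x y]
    s12[of x y w z] s12[of y z w x] s12[of z x w y] s12[of w x z y] s12[of y w x z] s12[of z w y x]
    H by simp

text \<open>Think of \<open>A\<close> as having eigenvalues \<open>\<plusminus> sqrt (- k)\<close>. The hypotheses on \<open>A\<close> say that \<open>r\<close> vanishes
  when one of its two pairs of arguments consists of eigenvectors with different eigenvalues, and the
  Bianchi identity then kills \<open>r\<close> when the pairs belong to different eigenvalues. The form \<open>q\<close>
  carries one \<open>A\<close> in each pair, and \<open>q = - k * r\<close> expresses that only arguments of one kind
  survive. Replacing the second pair by its image under \<open>P\<close> preserves \<open>r\<close> but, as \<open>P\<close> anticommutes
  with \<open>A\<close>, reverses the sign of \<open>q\<close>.\<close>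

lemma curvature_algebra_zero:
  fixes r :: "'v \<Rightarrow> 'v \<Rightarrow> 'v \<Rightarrow> 'v \<Rightarrow> real"
  assumes cl: "\<And>x. x \<in> H \<Longrightarrow> A x \<in> H" "\<And>x. x \<in> H \<Longrightarrow> P x \<in> H"
    and s12: "\<And>x y z w. \<lbrakk>x \<in> H; y \<in> H; z \<in> H; w \<in> H\<rbrakk> \<Longrightarrow> r y x z w = - r x y z w"
    and s34: "\<And>x y z w. \<lbrakk>x \<in> H; y \<in> H; z \<in> H; w \<in> H\<rbrakk> \<Longrightarrow> r x y w z = - r x y z w"
    and bianchi: "\<And>x y z w. \<lbrakk>x \<in> H; y \<in> H; z \<in> H; w \<in> H\<rbrakk> \<Longrightarrow> r x y z w + r y z x w + r z x y w = 0"
    and A: "\<And>x y z w. \<lbrakk>x \<in> H; y \<in> H; z \<in> H; w \<in> H\<rbrakk> \<Longrightarrow> r x y (A z) w = r x y z (A w)"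
    and P: "\<And>x y z w. \<lbrakk>x \<in> H; y \<in> H; z \<in> H; w \<in> H\<rbrakk> \<Longrightarrow> r x y (P z) w = - r x y z (P w)"
    and AA: "\<And>x y z w. \<lbrakk>x \<in> H; y \<in> H; z \<in> H; w \<in> H\<rbrakk> \<Longrightarrow> r x y z (A (A w)) = - k * r x y z w"
    and PP: "\<And>x y z w. \<lbrakk>x \<in> H; y \<in> H; z \<in> H; w \<in> H\<rbrakk> \<Longrightarrow> r x y z (P (P w)) = - r x y z w"
    and AP: "\<And>x y z w. \<lbrakk>x \<in> H; y \<in> H; z \<in> H; w \<in> H\<rbrakk> \<Longrightarrow> r x y z (A (P w)) = - r x y z (P (A w))"
    and k: "k \<noteq> 0"
    and H: "x \<in> H" "y \<in> H" "z \<in> H" "w \<in> H"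
  shows "r x y z w = 0"
proof -
  have pair: "r x y z w = r z w x y" if "x \<in> H" "y \<in> H" "z \<in> H" "w \<in> H" for x y z w
    using pair_symmetry[of H r, OF s12 s34 bianchi that] .
  have A': "r (A x) y z w = r x (A y) z w" if "x \<in> H" "y \<in> H" "z \<in> H" "w \<in> H" for x y z w
    using pair[of "A x" y z w] pair[of x "A y" z w] A[of z w x y] that cl by simp
  have AA': "r (A x) (A y) z w = - k * r x y z w" if "x \<in> H" "y \<in> H" "z \<in> H" "w \<in> H" for x y z w
    using A'[of x "A y" z w] pair[of x "A (A y)" z w] AA[of z w x y] pair[of x y z w] that cl by simp
  define q where "q x y z w = r (A x) y z (A w)" for x y z w
  have b1: "- k * r x y z w + q y z x w + q z x y w = 0"
    if "x \<in> H" "y \<in> H" "z \<in> H" "w \<in> H" for x y z w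
    using bianchi[of "A x" "A y" z w] AA'[of x y z w] A'[of y z "A x" w] A'[of z x "A y" w] A[of "A y" z x w]
      A'[of z "A x" y w] A[of "A z" x y w] A[of z "A x" y w]
    by (simp add: q_def that cl)
  have q: "k * r x y z w = - q x y z w" if "x \<in> H" "y \<in> H" "z \<in> H" "w \<in> H" for x y z w
  proof -
    have 1: "q x y z w + q z x y w = k * r y z x w"
      using b1[of y z x w] that by simp
    have 2: "q y z x w + q z x y w = k * r x y z w"
      using b1[of x y z w] that by simp
    have 3: "q x y z w + q y z x w = k * r z x y w"
      using b1[of z x y w] that by simp
    have "k * (r x y z w + r y z x w + r z x y w) = 0"
      using bianchi that by simp
    then show ?thesis
      using 1 2 3 by (simp add: distrib_left)
  qed
  have rP: "r x y (P z) (P w) = r x y z w" if "x \<in> H" "y \<in> H" for x y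
    using P[of x y z "P w"] PP[of x y z w] that H cl by simp
  have "q x y (P z) (P w) = - q x y z w"
    using AP[of "A x" y "P z" w] P[of "A x" y z "P (A w)"] PP[of "A x" y z "A w"] H cl
    by (simp add: q_def)
  then have "k * r x y z w = 0"
    using q[of x y z w] q[of x y "P z" "P w"] rP H cl by simp
  then show ?thesis using k by simp
qed

text \<open>For \<open>F x y z = g ((\<nabla>\<^bsub>x\<^esub> P) y) z\<close> this says that an almost Kaehler structure \<open>P\<close> is
  parallel if there is a parallel symmetric \<open>A\<close> anticommuting with \<open>P\<close> with \<open>A\<^sup>2 = - k\<close>. The form
  \<open>S x y w = F x y (P w)\<close> is skew in its last two arguments and, for \<open>x, y, w\<close> in one eigenspace of
  \<open>A\<close>, symmetric in its first two by the cyclic identity; a form that is both vanishes.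
  The form \<open>Q\<close> isolates this case: it is \<open>S\<close> composed, up to a factor, with the projection onto
  pairs \<open>x, y\<close> with the same eigenvalue.\<close>

lemma kaehler_algebra:
  fixes F :: "'v \<Rightarrow> 'v \<Rightarrow> 'v \<Rightarrow> real"
  assumes cl: "\<And>x. x \<in> H \<Longrightarrow> A x \<in> H" "\<And>x. x \<in> H \<Longrightarrow> P x \<in> H"
    and skew: "\<And>x y z. \<lbrakk>x \<in> H; y \<in> H; z \<in> H\<rbrakk> \<Longrightarrow> F x z y = - F x y z"
    and cyclic: "\<And>x y z. \<lbrakk>x \<in> H; y \<in> H; z \<in> H\<rbrakk> \<Longrightarrow> F x y z + F y z x + F z x y = 0"
    and A: "\<And>x y z. \<lbrakk>x \<in> H; y \<in> H; z \<in> H\<rbrakk> \<Longrightarrow> F x (A y) z = - F x y (A z)"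
    and P: "\<And>x y z. \<lbrakk>x \<in> H; y \<in> H; z \<in> H\<rbrakk> \<Longrightarrow> F x (P y) z = F x y (P z)"
    and AA: "\<And>x y z. \<lbrakk>x \<in> H; y \<in> H; z \<in> H\<rbrakk> \<Longrightarrow> F x y (A (A z)) = - k * F x y z"
    and PP: "\<And>x y z. \<lbrakk>x \<in> H; y \<in> H; z \<in> H\<rbrakk> \<Longrightarrow> F x y (P (P z)) = - F x y z"
    and AP: "\<And>x y z. \<lbrakk>x \<in> H; y \<in> H; z \<in> H\<rbrakk> \<Longrightarrow> F x y (A (P z)) = - F x y (P (A z))"
    and k: "k \<noteq> 0"
    and H: "x \<in> H" "y \<in> H" "z \<in> H"
  shows "F x y z = 0"
proof -
  define S where "S x y w = F x y (P w)" for x y w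
  have S_skew: "S x w y = - S x y w" if "x \<in> H" "y \<in> H" "w \<in> H" for x y w
    using P[of x y w] skew[of x "P y" w] that cl by (simp add: S_def)
  have S_A: "S x (A y) w = S x y (A w)" if "x \<in> H" "y \<in> H" "w \<in> H" for x y w
    using A[of x y "P w"] AP[of x y w] that cl by (simp add: S_def)
  define E where "E x y w = S x y w - S y x w" for x y w
  have E: "E x y w = - F (P w) x y" if "x \<in> H" "y \<in> H" "w \<in> H" for x y w
    using cyclic[of x y "P w"] skew[of y x "P w"] that cl by (simp add: E_def S_def)
  have F_AA: "F v (A x) (A y) = k * F v x y" if "v \<in> H" "x \<in> H" "y \<in> H" for v x y
    using A[of v x "A y"] AA[of v x y] that cl by simp
  have E_A: "E (A x) (A y) w = k * E x y w" if "x \<in> H" "y \<in> H" "w \<in> H" for x y w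
    using E[of "A x" "A y" w] E[of x y w] F_AA[of "P w" x y] that cl by simp
  define Q where "Q x y w = S (A x) (A y) w - k * S x y w" for x y w
  have Q_sym: "Q x y w = Q y x w" if "x \<in> H" "y \<in> H" "w \<in> H" for x y w
    using E_A[OF that] by (simp add: Q_def E_def algebra_simps)
  have Q_skew: "Q x w y = - Q x y w" if "x \<in> H" "y \<in> H" "w \<in> H" for x y w
    using S_skew[of x y w] S_skew[of "A x" "A y" w] S_A[of "A x" w y] that cl
      S_skew[of "A x" "A w" y]
    by (simp add: Q_def)
  \<comment> \<open>Symmetry in the first and skewness in the last two arguments.\<close>
  have Q0: "Q x y w = 0" if "x \<in> H" "y \<in> H" "w \<in> H" for x y w
    using Q_sym[of x y w] Q_skew[of y x w] Q_sym[of y w x] Q_skew[of w y x] Q_sym[of w x y] Q_skew[of x w y] that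
    by simp
  have S_P: "S x (P y) (P w) = - S x y w" if "x \<in> H" "y \<in> H" "w \<in> H" for x y w
    using PP[of x "P y" w] P[of x y w] that cl by (simp add: S_def)
  \<comment> \<open>Passing to \<open>P y\<close>, \<open>P w\<close> exchanges the eigenspaces of the last two arguments, so \<open>Q = 0\<close> also covers the case of \<open>x\<close> with the other eigenvalue.\<close>
  have Sz: "S x y w = 0" if "x \<in> H" "y \<in> H" "w \<in> H" for x y w
  proof -
    have "S (A x) (A (P y)) (P w) = - S (A x) (P (A y)) (P w)"
      using S_skew[of "A x" "A (P y)" "P w"] S_skew[of "A x" "P (A y)" "P w"]
        P[of "A x" "P w" "A (P y)"] P[of "A x" "P w" "P (A y)"]
        AP[of "A x" "P (P w)" y] that cl
      by (simp add: S_def)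
    then have "S (A x) (A (P y)) (P w) = S (A x) (A y) w"
      using S_P[of "A x" "A y" w] that cl by simp
    then have "k * S x y w = 0"
      using Q0[of x y w] Q0[of x "P y" "P w"] S_P[of x y w] that cl by (simp add: Q_def)
    then show ?thesis using k by simp
  qed
  show ?thesis
    using Sz[of x y "P z"] PP[of x y z] H cl by (simp add: S_def)
qed

section \<open>Metric connections and their curvature\<close>

definition cov_deriv11 ::
  "('a vfield \<Rightarrow> 'a vfield \<Rightarrow> 'a vfield) \<Rightarrow> ('a vfield \<Rightarrow> 'a vfield) \<Rightarrow> 'a vfield \<Rightarrow> 'a vfield \<Rightarrow> 'a vfield"
  where "cov_deriv11 D T X Y = D X (T Y) - T (D X Y)"

lemma lie_bracket_antisym: "lie_bracket Y X = - lie_bracket X Y"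
  by (simp add: lie_bracket_def fun_eq_iff)

locale riemannian_manifold = manifold A
  for A :: "('a::{t2_space,second_countable_topology}, 'e::euclidean_space) atlas" +
  fixes g :: "'a vfield \<Rightarrow> 'a vfield \<Rightarrow> 'a \<Rightarrow> real"
    and nab :: "'a vfield \<Rightarrow> 'a vfield \<Rightarrow> 'a vfield"
  assumes metric: "riemannian_metric A g"
    and levi_civita: "levi_civita A g nab"
begin

lemma g_one_form: "vf X \<Longrightarrow> one_form A (g X)"
  using metric by (simp add: riemannian_metric_def)

lemma g_sym: "vf X \<Longrightarrow> vf Y \<Longrightarrow> g X Y = g Y X"
  using metric by (simp add: riemannian_metric_def)

lemma sf_g [simp, intro]: "vf X \<Longrightarrow> vf Y \<Longrightarrow> sf (g X Y)"
  using g_one_form by (simp add: one_form_def)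

lemma g_add_right: "vf X \<Longrightarrow> vf Y \<Longrightarrow> vf Z \<Longrightarrow> g X (Y + Z) = g X Y + g X Z"
  and g_fscale_right: "vf X \<Longrightarrow> vf Y \<Longrightarrow> sf u \<Longrightarrow> g X (u \<odot> Y) = u * g X Y"
  using g_one_form by (simp_all add: one_form_def)

lemma g_add_left: "vf X \<Longrightarrow> vf Y \<Longrightarrow> vf Z \<Longrightarrow> g (X + Y) Z = g X Z + g Y Z"
  by (simp add: g_sym[of _ Z] g_add_right)

lemma g_fscale_left: "vf X \<Longrightarrow> vf Y \<Longrightarrow> sf u \<Longrightarrow> g (u \<odot> X) Y = u * g X Y"
  by (simp add: g_sym[of _ Y] g_fscale_right)

lemma g_minus_right: "vf X \<Longrightarrow> vf Y \<Longrightarrow> g X (- Y) = - g X Y"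
  using g_fscale_right[of X Y "- 1"] by (simp add: fscale_minus_left fscale_one)

lemma g_minus_left: "vf X \<Longrightarrow> vf Y \<Longrightarrow> g (- X) Y = - g X Y"
  by (simp add: g_sym[of _ Y] g_minus_right)

lemma g_diff_right: "vf X \<Longrightarrow> vf Y \<Longrightarrow> vf Z \<Longrightarrow> g X (Y - Z) = g X Y - g X Z"
  using g_add_right[of X Y "- Z"] by (simp add: g_minus_right)

lemma g_diff_left: "vf X \<Longrightarrow> vf Y \<Longrightarrow> vf Z \<Longrightarrow> g (X - Y) Z = g X Z - g Y Z"
  by (simp add: g_sym[of _ Z] g_diff_right)

lemma g_0_right: "vf X \<Longrightarrow> g X 0 = 0"
  using g_diff_right[of X X X] by simp

lemma g_0_left: "vf X \<Longrightarrow> g 0 X = 0"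
  using g_0_right[of X] g_sym[of 0 X] by simp

lemmas g_linear = g_add_right g_add_left g_fscale_right g_fscale_left g_minus_right g_minus_left
  g_diff_right g_diff_left g_0_right g_0_left

lemma g_pos: "vf X \<Longrightarrow> X p \<noteq> 0 \<Longrightarrow> g X X p > 0"
  using metric by (simp add: riemannian_metric_def)

lemma g_self_eq_0: "vf X \<Longrightarrow> g X X = 0 \<Longrightarrow> X = 0"
  using g_pos[of X] by (metis ext less_irrefl zero_fun_apply)

lemma g_eqI:
  assumes "vf X" "vf Y" "\<And>Z. vf Z \<Longrightarrow> g X Z = g Y Z"
  shows "X = Y"
  using g_self_eq_0[of "X - Y"] assms by (simp add: g_linear)

lemma nab_tensor: "vf Y \<Longrightarrow> tensor11 A (\<lambda>X. nab X Y)"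
  using levi_civita by (simp add: levi_civita_def affine_connection_def)

lemma vf_nab [simp, intro]: "vf X \<Longrightarrow> vf Y \<Longrightarrow> vf (nab X Y)"
  and nab_add_left: "vf X \<Longrightarrow> vf X' \<Longrightarrow> vf Y \<Longrightarrow> nab (X + X') Y = nab X Y + nab X' Y"
  and nab_fscale_left: "vf X \<Longrightarrow> vf Y \<Longrightarrow> sf u \<Longrightarrow> nab (u \<odot> X) Y = u \<odot> nab X Y"
  using nab_tensor by (simp_all add: tensor11_def)

lemma nab_add: "vf X \<Longrightarrow> vf Y \<Longrightarrow> vf Z \<Longrightarrow> nab X (Y + Z) = nab X Y + nab X Z"
  and nab_fscale: "vf X \<Longrightarrow> vf Y \<Longrightarrow> sf u \<Longrightarrow> nab X (u \<odot> Y) = deriv_along X u \<odot> Y + u \<odot> nab X Y"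
  and torsion_free: "vf X \<Longrightarrow> vf Y \<Longrightarrow> nab X Y - nab Y X = lie_bracket X Y"
  and nab_metric: "vf X \<Longrightarrow> vf Y \<Longrightarrow> vf Z \<Longrightarrow> deriv_along X (g Y Z) = g (nab X Y) Z + g Y (nab X Z)"
  using levi_civita by (simp_all add: levi_civita_def affine_connection_def)

lemma vf_lie_bracket [simp, intro]: "vf X \<Longrightarrow> vf Y \<Longrightarrow> vf (lie_bracket X Y)"
  using torsion_free[of X Y] by (metis vf_diff vf_nab)

lemma nab_minus_left: "vf X \<Longrightarrow> vf Y \<Longrightarrow> nab (- X) Y = - nab X Y"
  using nab_fscale_left[of X Y "- 1"] by (simp add: fscale_minus_left fscale_one)

lemma nab_diff_left: "vf X \<Longrightarrow> vf X' \<Longrightarrow> vf Y \<Longrightarrow> nab (X - X') Y = nab X Y - nab X' Y"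
  using nab_add_left[of X "- X'" Y] by (simp add: nab_minus_left)

lemma nab_0_right: "vf X \<Longrightarrow> nab X 0 = 0"
  using nab_add[of X 0 0] by simp

lemma nab_minus: "vf X \<Longrightarrow> vf Y \<Longrightarrow> nab X (- Y) = - nab X Y"
  using nab_add[of X Y "- Y"] by (simp add: nab_0_right eq_neg_iff_add_eq_0 add.commute)

lemma nab_diff: "vf X \<Longrightarrow> vf Y \<Longrightarrow> vf Z \<Longrightarrow> nab X (Y - Z) = nab X Y - nab X Z"
  using nab_add[of X Y "- Z"] by (simp add: nab_minus)

lemmas nab_linear = nab_add nab_fscale nab_minus nab_diff nab_0_right
  nab_add_left nab_fscale_left nab_minus_left nab_diff_left

text \<open>The common ground of the Levi-Civita connection and of the leaf connection, which has torsion, on which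
  the curvature identities rest.\<close>

definition metric_connection :: "('a vfield \<Rightarrow> 'a vfield \<Rightarrow> 'a vfield) \<Rightarrow> bool" where
  "metric_connection D \<longleftrightarrow>
    (\<forall>X Y. vf X \<longrightarrow> vf Y \<longrightarrow> vf (D X Y)) \<and>
    (\<forall>X Y Z. vf X \<longrightarrow> vf Y \<longrightarrow> vf Z \<longrightarrow> D X (Y - Z) = D X Y - D X Z) \<and>
    (\<forall>X Y. vf X \<longrightarrow> vf Y \<longrightarrow> D (- X) Y = - D X Y) \<and>
    (\<forall>X Y Z. vf X \<longrightarrow> vf Y \<longrightarrow> vf Z \<longrightarrow> deriv_along X (g Y Z) = g (D X Y) Z + g Y (D X Z))"

lemma metric_connection_nab: "metric_connection nab"
  by (simp add: metric_connection_def nab_diff nab_minus_left nab_metric)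

context
  fixes D
  assumes D: "metric_connection D"
begin

lemma connection_vf [simp, intro]: "vf X \<Longrightarrow> vf Y \<Longrightarrow> vf (D X Y)"
  and connection_diff: "vf X \<Longrightarrow> vf Y \<Longrightarrow> vf Z \<Longrightarrow> D X (Y - Z) = D X Y - D X Z"
  and connection_minus_left: "vf X \<Longrightarrow> vf Y \<Longrightarrow> D (- X) Y = - D X Y"
  and connection_metric: "vf X \<Longrightarrow> vf Y \<Longrightarrow> vf Z \<Longrightarrow> deriv_along X (g Y Z) = g (D X Y) Z + g Y (D X Z)"
  using D by (simp_all add: metric_connection_def)

lemma vf_curvature: "vf X \<Longrightarrow> vf Y \<Longrightarrow> vf Z \<Longrightarrow> vf (curvature D X Y Z)"
  by (simp add: curvature_def)

lemma curvature_antisym: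
  assumes "vf X" "vf Y" "vf Z"
  shows "curvature D Y X Z = - curvature D X Y Z"
  using assms by (simp add: curvature_def lie_bracket_antisym[of Y X] connection_minus_left)

lemma curvature_skew:
  assumes [simp]: "vf X" "vf Y" "vf Z" "vf W"
  shows "g (curvature D X Y Z) W = - g (curvature D X Y W) Z"
proof -
  have second: "deriv_along X (deriv_along Y (g Z W)) =
      g (D X (D Y Z)) W + g (D Y Z) (D X W) + g (D X Z) (D Y W) + g Z (D X (D Y W))"
    if [simp]: "vf X" "vf Y" for X Y
    by (simp add: connection_metric deriv_along_add)
  have "g (D (lie_bracket X Y) Z) W + g Z (D (lie_bracket X Y) W) =
      deriv_along X (deriv_along Y (g Z W)) - deriv_along Y (deriv_along X (g Z W))"
    using deriv_along_lie_bracket[of X Y "g Z W"] connection_metric[of "lie_bracket X Y" Z W] by simp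
  then show ?thesis
    unfolding second[OF assms(1,2)] second[OF assms(2,1)]
    by (simp add: curvature_def g_linear g_sym[of _ Z] algebra_simps)
qed

text \<open>The torsion is only assumed to vanish on a set \<open>S\<close> closed under the connection and the bracket; for
  the leaf connection \<open>S\<close> consists of the horizontal fields.\<close>

lemma first_bianchi:
  assumes S: "S \<subseteq> Collect vf" "\<And>X Y. X \<in> S \<Longrightarrow> Y \<in> S \<Longrightarrow> D X Y \<in> S"
    "\<And>X Y. X \<in> S \<Longrightarrow> Y \<in> S \<Longrightarrow> lie_bracket X Y \<in> S"
    and torsion: "\<And>X Y. X \<in> S \<Longrightarrow> Y \<in> S \<Longrightarrow> D X Y - D Y X = lie_bracket X Y"
    and XYZ: "X \<in> S" "Y \<in> S" "Z \<in> S"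
  shows "curvature D X Y Z + curvature D Y Z X + curvature D Z X Y = 0"
proof -
  have vf: "vf V" if "V \<in> S" for V using S that by auto
  have step: "D U (D V W) - D U (D W V) - D (lie_bracket V W) U = lie_bracket U (lie_bracket V W)"
    if "U \<in> S" "V \<in> S" "W \<in> S" for U V W
    using connection_diff[of U "D V W" "D W V"] torsion[of V W] torsion[of U "lie_bracket V W"] that S(2,3) vf
    by simp
  have "curvature D X Y Z + curvature D Y Z X + curvature D Z X Y =
      (D X (D Y Z) - D X (D Z Y) - D (lie_bracket Y Z) X)
      + (D Y (D Z X) - D Y (D X Z) - D (lie_bracket Z X) Y)
      + (D Z (D X Y) - D Z (D Y X) - D (lie_bracket X Y) Z)"
    by (simp add: curvature_def algebra_simps)
  also have "\<dots> = 0"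
    using step[of X Y Z] step[of Y Z X] step[of Z X Y] jacobi_identity[of X Y Z] XYZ vf by simp
  finally show ?thesis .
qed

lemma cov_deriv_symmetric:
  assumes [simp]: "\<And>X. vf X \<Longrightarrow> vf (T X)"
    and T: "\<And>X Y. vf X \<Longrightarrow> vf Y \<Longrightarrow> g (T X) Y = g X (T Y)"
    and [simp]: "vf X" "vf Y" "vf Z"
  shows "g (cov_deriv11 D T X Y) Z = g Y (cov_deriv11 D T X Z)"
proof -
  have "g (D X (T Y)) Z + g (T Y) (D X Z) = g (D X Y) (T Z) + g Y (D X (T Z))"
    using connection_metric[of X "T Y" Z] connection_metric[of X Y "T Z"] T[of Y Z] by simp
  then show ?thesis
    by (simp add: cov_deriv11_def g_linear T[of "D X Y" Z] T[of Y "D X Z", symmetric] algebra_simps)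
qed

lemma cov_deriv_skew:
  assumes [simp]: "\<And>X. vf X \<Longrightarrow> vf (T X)"
    and T: "\<And>X Y. vf X \<Longrightarrow> vf Y \<Longrightarrow> g (T X) Y = - g X (T Y)"
    and [simp]: "vf X" "vf Y" "vf Z"
  shows "g (cov_deriv11 D T X Y) Z = - g (cov_deriv11 D T X Z) Y"
proof -
  have 1: "g (D X (T Y)) Z + g (T Y) (D X Z) = - (g (D X Y) (T Z) + g Y (D X (T Z)))"
    using connection_metric[of X "T Y" Z] connection_metric[of X Y "T Z"] T[of Y Z] deriv_along_uminus[of X "g Y (T Z)"]
    by simp
  have "g (cov_deriv11 D T X Y) Z = g (D X (T Y)) Z + g (D X Y) (T Z)"
    by (simp add: cov_deriv11_def g_linear T[of "D X Y" Z])
  moreover have "g (cov_deriv11 D T X Z) Y = g Y (D X (T Z)) + g (T Y) (D X Z)"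
    by (simp add: cov_deriv11_def g_linear T[of "D X Z" Y] g_sym[of "D X (T Z)" Y]
        g_sym[of "D X Z" "T Y"])
  ultimately show ?thesis
    using 1 by (simp add: algebra_simps)
qed

text \<open>As for any torsion-free connection, the exterior derivative is the cyclic sum of covariant
  derivatives. The hypotheses on the torsion are stated for
  three given fields so that the leaf connection qualifies on horizontal ones.\<close>

lemma ext_deriv2_cov_deriv:
  assumes [simp]: "\<And>X. vf X \<Longrightarrow> vf (T X)"
    and T: "\<And>X Y. vf X \<Longrightarrow> vf Y \<Longrightarrow> g (T X) Y = - g X (T Y)"
    and [simp]: "vf X" "vf Y" "vf Z"
    and torsion: "D X Y - D Y X = lie_bracket X Y" "D Y Z - D Z Y = lie_bracket Y Z"
      "D Z X - D X Z = lie_bracket Z X"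
  shows "ext_deriv2 (fundamental_form T g) X Y Z =
    g (cov_deriv11 D T X Z) Y + g (cov_deriv11 D T Y X) Z + g (cov_deriv11 D T Z Y) X"
proof -
  have e: "deriv_along U (g V (T W)) = g (D U V) (T W) + g (cov_deriv11 D T U W) V - g (D U W) (T V)"
    if [simp]: "vf U" "vf V" "vf W" for U V W
    using T[of V "D U W"] g_sym[of "T V" "D U W"] g_sym[of "D U (T W)" V] g_sym[of "T (D U W)" V]
    by (simp add: connection_metric cov_deriv11_def g_linear)
  show ?thesis
    unfolding ext_deriv2_def fundamental_form_def torsion[symmetric]
    by (simp add: e g_linear algebra_simps)
qed

lemma curvature_commutes:
  assumes S: "S \<subseteq> Collect vf" "\<And>X Y. X \<in> S \<Longrightarrow> Y \<in> S \<Longrightarrow> D X Y \<in> S"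
    "\<And>X Y. X \<in> S \<Longrightarrow> Y \<in> S \<Longrightarrow> lie_bracket X Y \<in> S"
    and T: "\<And>X. X \<in> S \<Longrightarrow> T X \<in> S"
    and Tdiff: "\<And>X Y. vf X \<Longrightarrow> vf Y \<Longrightarrow> T (X - Y) = T X - T Y"
    and par: "\<And>X Y. X \<in> S \<Longrightarrow> Y \<in> S \<Longrightarrow> cov_deriv11 D T X Y = 0"
    and XYZ: "X \<in> S" "Y \<in> S" "Z \<in> S"
  shows "curvature D X Y (T Z) = T (curvature D X Y Z)"
proof -
  have vf: "vf V" if "V \<in> S" for V using S that by auto
  have DT: "D U (T V) = T (D U V)" if "U \<in> S" "V \<in> S" for U V
    using par[OF that] by (simp add: cov_deriv11_def)
  show ?thesis
    using XYZ S by (simp add: curvature_def DT Tdiff vf)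
qed

end

lemma curvature_pair_symmetry:
  assumes "vf X" "vf Y" "vf Z" "vf W"
  shows "g (curvature nab X Y Z) W = g (curvature nab Z W X) Y"
proof
  fix p
  show "g (curvature nab X Y Z) W p = g (curvature nab Z W X) Y p"
  proof (rule pair_symmetry[of "Collect vf" "\<lambda>X Y Z W. g (curvature nab X Y Z) W p"])
    fix X Y Z W assume "X \<in> Collect vf" "Y \<in> Collect vf" "Z \<in> Collect vf" "W \<in> Collect vf"
    then have v [simp]: "vf X" "vf Y" "vf Z" "vf W" by auto
    note [simp] = vf_curvature[OF metric_connection_nab]
    show "g (curvature nab Y X Z) W p = - g (curvature nab X Y Z) W p"
      by (simp add: curvature_antisym[OF metric_connection_nab, of X Y] g_linear)
    show "g (curvature nab X Y W) Z p = - g (curvature nab X Y Z) W p"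
      by (simp add: curvature_skew[OF metric_connection_nab, of X Y W])
    have "curvature nab X Y Z + curvature nab Y Z X + curvature nab Z X Y = 0"
      by (rule first_bianchi[OF metric_connection_nab, of "Collect vf"]) (auto simp: torsion_free)
    then have "g (curvature nab X Y Z + curvature nab Y Z X + curvature nab Z X Y) W p = 0"
      by (simp add: g_0_left)
    then show "g (curvature nab X Y Z) W p + g (curvature nab Y Z X) W p + g (curvature nab Z X Y) W p = 0"
      by (simp add: g_linear)
  qed (use assms in auto)
qed

end

section \<open>Almost cosymplectic manifolds\<close>

lemma double_eq_0: "X + X = 0 \<Longrightarrow> X = (0 :: 'a vfield)"
  by (auto simp: fun_eq_iff)

locale almost_cosymplectic_manifold = riemannian_manifold A g nab
  for A :: "('a::{t2_space,second_countable_topology}, 'e::euclidean_space) atlas"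
    and g :: "'a vfield \<Rightarrow> 'a vfield \<Rightarrow> 'a \<Rightarrow> real"
    and nab :: "'a vfield \<Rightarrow> 'a vfield \<Rightarrow> 'a vfield" +
  fixes \<phi> :: "'a vfield \<Rightarrow> 'a vfield"
    and \<xi> :: "'a vfield"
    and \<eta> :: "'a vfield \<Rightarrow> 'a \<Rightarrow> real"
  assumes cosymplectic: "almost_cosymplectic A \<phi> \<xi> \<eta> g"
begin

lemma contact: "almost_contact_metric A \<phi> \<xi> \<eta> g"
  using cosymplectic by (simp add: almost_cosymplectic_def)

lemma phi_tensor: "tensor11 A \<phi>" and eta_form: "one_form A \<eta>"
  and vf_xi [simp, intro]: "vf \<xi>" and eta_xi: "\<eta> \<xi> = 1"
  and phi_phi: "vf X \<Longrightarrow> \<phi> (\<phi> X) = - X + \<eta> X \<odot> \<xi>"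
  and g_phi_phi: "vf X \<Longrightarrow> vf Y \<Longrightarrow> g (\<phi> X) (\<phi> Y) = g X Y - \<eta> X * \<eta> Y"
  using contact by (simp_all add: almost_contact_metric_def)

lemma vf_phi [simp, intro]: "vf X \<Longrightarrow> vf (\<phi> X)"
  and phi_add: "vf X \<Longrightarrow> vf Y \<Longrightarrow> \<phi> (X + Y) = \<phi> X + \<phi> Y"
  and phi_fscale: "vf X \<Longrightarrow> sf u \<Longrightarrow> \<phi> (u \<odot> X) = u \<odot> \<phi> X"
  using phi_tensor by (simp_all add: tensor11_def)

lemma phi_minus: "vf X \<Longrightarrow> \<phi> (- X) = - \<phi> X"
  using phi_fscale[of X "- 1"] by (simp add: fscale_minus_left fscale_one)

lemma phi_diff: "vf X \<Longrightarrow> vf Y \<Longrightarrow> \<phi> (X - Y) = \<phi> X - \<phi> Y"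
  using phi_add[of X "- Y"] by (simp add: phi_minus)

lemma phi_0: "\<phi> 0 = 0"
  using phi_diff[of 0 0] by simp

lemma sf_eta [simp, intro]: "vf X \<Longrightarrow> sf (\<eta> X)"
  and eta_add: "vf X \<Longrightarrow> vf Y \<Longrightarrow> \<eta> (X + Y) = \<eta> X + \<eta> Y"
  and eta_fscale: "vf X \<Longrightarrow> sf u \<Longrightarrow> \<eta> (u \<odot> X) = u * \<eta> X"
  using eta_form by (simp_all add: one_form_def)

lemma eta_minus: "vf X \<Longrightarrow> \<eta> (- X) = - \<eta> X"
  using eta_fscale[of X "- 1"] by (simp add: fscale_minus_left fscale_one)

lemma eta_diff: "vf X \<Longrightarrow> vf Y \<Longrightarrow> \<eta> (X - Y) = \<eta> X - \<eta> Y"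
  using eta_add[of X "- Y"] by (simp add: eta_minus)

lemma eta_0: "\<eta> 0 = 0"
  using eta_diff[of 0 0] by simp

lemmas phi_linear = phi_add phi_fscale phi_minus phi_diff phi_0
lemmas eta_linear = eta_add eta_fscale eta_minus eta_diff eta_0 eta_xi

text \<open>Applying \<open>\<phi>\<^sup>2\<close> to \<open>\<phi> \<xi>\<close> shows \<open>\<phi> \<xi> = a \<xi>\<close>, and then \<open>\<phi>\<^sup>2 \<xi> = 0\<close> gives \<open>a\<^sup>2 = 0\<close>.\<close>

lemma phi_xi: "\<phi> \<xi> = 0"
proof -
  define a where "a = \<eta> (\<phi> \<xi>)"
  have [simp]: "sf a" by (simp add: a_def)
  have 0: "\<phi> (\<phi> \<xi>) = 0"
    by (simp add: phi_phi eta_xi fscale_one)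
  have x: "\<phi> \<xi> = a \<odot> \<xi>"
    using phi_phi[of "\<phi> \<xi>"] by (simp add: 0 phi_0 a_def)
  have "(a * a) \<odot> \<xi> = 0"
    using 0 x by (simp add: phi_fscale fscale_fscale)
  then have "\<eta> ((a * a) \<odot> \<xi>) = 0"
    by (simp add: eta_0)
  then have "a * a = 0"
    by (simp add: eta_fscale eta_xi)
  then have "a = 0"
    by (auto simp: fun_eq_iff)
  then show ?thesis
    using x by (simp add: fscale_zero_left)
qed

lemma g_xi_right: "vf X \<Longrightarrow> g X \<xi> = \<eta> X"
  using g_phi_phi[of X \<xi>] by (simp add: phi_xi g_0_right eta_xi)

lemma g_xi_left: "vf X \<Longrightarrow> g \<xi> X = \<eta> X"
  by (simp add: g_sym[of \<xi>] g_xi_right)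

lemma eta_phi: "vf X \<Longrightarrow> \<eta> (\<phi> X) = 0"
proof -
  assume [simp]: "vf X"
  have "\<phi> (\<phi> (\<phi> X)) = - \<phi> X"
    by (subst phi_phi[of X]) (simp_all add: phi_linear phi_xi fscale_zero_right)
  then have "\<eta> (\<phi> X) \<odot> \<xi> = 0"
    by (simp add: phi_phi[of "\<phi> X"])
  then have "\<eta> (\<eta> (\<phi> X) \<odot> \<xi>) = 0"
    by (simp add: eta_0)
  then show ?thesis
    by (simp add: eta_linear)
qed

lemma phi_skew: "vf X \<Longrightarrow> vf Y \<Longrightarrow> g (\<phi> X) Y = - g X (\<phi> Y)"
  using g_phi_phi[of "\<phi> X" Y]
  by (simp add: phi_phi g_linear g_xi_left eta_phi minus_equation_iff eq_commute)

text \<open>The shape operator of the leaves of \<open>ker \<eta>\<close> with unit normal \<open>\<xi>\<close>.\<close>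

definition shape :: "'a vfield \<Rightarrow> 'a vfield" where
  "shape X = - nab X \<xi>"

lemma vf_shape [simp, intro]: "vf X \<Longrightarrow> vf (shape X)"
  by (simp add: shape_def)

lemma shape_add: "vf X \<Longrightarrow> vf Y \<Longrightarrow> shape (X + Y) = shape X + shape Y"
  and shape_fscale: "vf X \<Longrightarrow> sf u \<Longrightarrow> shape (u \<odot> X) = u \<odot> shape X"
  and shape_minus: "vf X \<Longrightarrow> shape (- X) = - shape X"
  and shape_diff: "vf X \<Longrightarrow> vf Y \<Longrightarrow> shape (X - Y) = shape X - shape Y"
  by (simp_all add: shape_def nab_linear fscale_minus_right)

lemma nab_xi: "nab X \<xi> = - shape X"
  by (simp add: shape_def)

text \<open>The skew part of \<open>\<nabla>\<xi>\<close> is \<open>d\<eta>\<close>, up to a factor.\<close>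

lemma shape_symmetric:
  assumes [simp]: "vf X" "vf Y"
  shows "g (shape X) Y = g X (shape Y)"
proof -
  have "ext_deriv1 \<eta> X Y = 0"
    using cosymplectic by (simp add: almost_cosymplectic_def)
  then have "deriv_along X (g Y \<xi>) - deriv_along Y (g X \<xi>) - g (lie_bracket X Y) \<xi> = 0"
    by (simp add: ext_deriv1_def g_xi_right)
  then show ?thesis
    by (simp add: nab_metric nab_xi g_linear g_sym[of Y "shape X"] algebra_simps flip: torsion_free)
qed

lemma eta_shape: "vf X \<Longrightarrow> \<eta> (shape X) = 0"
proof -
  assume [simp]: "vf X"
  have "deriv_along X (g \<xi> \<xi>) = 0"
    by (simp only: g_xi_left[OF vf_xi] eta_xi deriv_along_1[OF \<open>vf X\<close>])
  then have "g (nab X \<xi>) \<xi> + g \<xi> (nab X \<xi>) = 0"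
    by (simp only: nab_metric[OF \<open>vf X\<close> vf_xi vf_xi])
  then have "\<eta> (shape X) + \<eta> (shape X) = 0"
    by (simp add: nab_xi g_xi_left g_xi_right eta_minus fun_eq_iff)
  then show ?thesis
    by (simp add: fun_eq_iff)
qed

lemma shape_xi: "shape \<xi> = 0"
  by (rule g_eqI) (simp_all add: shape_symmetric g_linear g_xi_left eta_shape)

lemma shape_0: "shape 0 = 0"
  using shape_diff[of 0 0] by simp

lemmas shape_linear = shape_add shape_fscale shape_minus shape_diff shape_0

lemma phi_phi_shape: "vf X \<Longrightarrow> \<phi> (\<phi> (shape X)) = - shape X"
  by (simp add: phi_phi eta_shape fscale_zero_left)

lemma shape_phi_phi: "vf X \<Longrightarrow> shape (\<phi> (\<phi> X)) = - shape X"
  by (simp add: phi_phi shape_linear shape_xi fscale_zero_right)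

lemma nab_xi_eta: "vf X \<Longrightarrow> \<eta> (nab \<xi> X) = deriv_along \<xi> (\<eta> X)"
  using nab_metric[of \<xi> X \<xi>] by (simp add: g_xi_right nab_xi shape_xi g_0_right)

text \<open>This is \<open>d\<Phi>(\<xi>, Y, X) = 0\<close>; the two terms on the right come from \<open>(\<nabla>\<phi>) \<xi> = \<phi> A\<close>.\<close>

lemma nab_xi_phi_formula:
  assumes [simp]: "vf X"
  shows "cov_deriv11 nab \<phi> \<xi> X = \<phi> (shape X) + shape (\<phi> X)"
proof (rule g_eqI)
  have vf_cov [simp]: "vf (cov_deriv11 nab \<phi> U V)" if "vf U" "vf V" for U V
    using that by (simp add: cov_deriv11_def)
  show "vf (cov_deriv11 nab \<phi> \<xi> X)" by simp
  show "vf (\<phi> (shape X) + shape (\<phi> X))" by simp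
  fix Y assume [simp]: "vf Y"
  have xi: "cov_deriv11 nab \<phi> U \<xi> = \<phi> (shape U)" if "vf U" for U
    using that by (simp add: cov_deriv11_def phi_xi nab_linear nab_xi phi_linear)
  have "ext_deriv2 (fundamental_form \<phi> g) \<xi> Y X = 0"
    using cosymplectic by (simp add: almost_cosymplectic_def)
  then have "g (cov_deriv11 nab \<phi> \<xi> X) Y + g (cov_deriv11 nab \<phi> Y \<xi>) X + g (cov_deriv11 nab \<phi> X Y) \<xi> = 0"
    by (subst (asm) ext_deriv2_cov_deriv[OF metric_connection_nab])
       (simp_all add: phi_skew torsion_free)
  moreover have "g (cov_deriv11 nab \<phi> X Y) \<xi> = - g (cov_deriv11 nab \<phi> X \<xi>) Y"
    by (rule cov_deriv_skew[OF metric_connection_nab]) (simp_all add: phi_skew)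
  moreover have "g (\<phi> (shape Y)) X = - g (shape (\<phi> X)) Y"
    using phi_skew[of "shape Y" X] shape_symmetric[of Y "\<phi> X"] g_sym[of Y "shape (\<phi> X)"] by simp
  ultimately show "g (cov_deriv11 nab \<phi> \<xi> X) Y = g (\<phi> (shape X) + shape (\<phi> X)) Y"
    by (simp add: xi g_linear algebra_simps)
qed

text \<open>Differentiating \<open>\<phi>\<^sup>2\<close> shows that \<open>\<nabla>\<^bsub>\<xi>\<^esub> \<phi>\<close> anticommutes with \<open>\<phi>\<close>, whereas the right-hand side
  \<open>\<phi> A + A \<phi>\<close> of \<open>nab_xi_phi_formula\<close> commutes with it. So \<open>\<phi>\<close> composed with it vanishes.\<close>

lemma nab_xi_phi:
  assumes [simp]: "vf X"
  shows "nab \<xi> (\<phi> X) = \<phi> (nab \<xi> X)"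
proof -
  let ?N = "cov_deriv11 nab \<phi> \<xi>"
  have [simp]: "vf (?N X)" by (simp add: cov_deriv11_def)
  have anti: "?N (\<phi> X) + \<phi> (?N X) = 0"
  proof -
    have "?N (\<phi> X) + \<phi> (?N X) = nab \<xi> (\<phi> (\<phi> X)) - \<phi> (\<phi> (nab \<xi> X))"
      by (simp add: cov_deriv11_def phi_linear)
    also have "\<dots> = 0"
      by (simp add: phi_phi nab_linear nab_xi shape_xi nab_xi_eta fscale_zero_right)
    finally show ?thesis .
  qed
  have "?N (\<phi> X) = \<phi> (?N X)"
    by (simp add: nab_xi_phi_formula phi_linear phi_phi_shape shape_phi_phi)
  then have "\<phi> (?N X) = 0"
    using anti by (metis double_eq_0)
  then have "\<phi> (\<phi> (?N X)) = 0"
    by (simp add: phi_0)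
  moreover have "\<eta> (?N X) = 0"
    by (simp add: nab_xi_phi_formula eta_linear eta_phi eta_shape)
  ultimately have "?N X = 0"
    by (simp add: phi_phi fscale_zero_left)
  then show ?thesis
    by (simp add: cov_deriv11_def)
qed

lemma shape_phi:
  assumes [simp]: "vf X"
  shows "shape (\<phi> X) = - \<phi> (shape X)"
proof -
  have "\<phi> (shape X) + shape (\<phi> X) = 0"
    using nab_xi_phi_formula[of X] nab_xi_phi[of X] by (simp add: cov_deriv11_def)
  then show ?thesis
    by (simp add: eq_neg_iff_add_eq_0 add.commute)
qed

lemma h_tensor_eq:
  assumes [simp]: "vf X"
  shows "h_tensor \<phi> \<xi> X = - \<phi> (shape X)"
proof -
  have "lie_deriv11 \<xi> \<phi> X = - \<phi> (shape X) - \<phi> (shape X)"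
    by (simp add: lie_deriv11_def nab_xi nab_xi_phi phi_linear shape_phi flip: torsion_free)
  then show ?thesis
    by (simp add: h_tensor_def fscale_def fun_eq_iff)
qed

end

section \<open>The connection of the leaves\<close>

context almost_cosymplectic_manifold
begin

definition horizontal :: "'a vfield set" where
  "horizontal = {X. vf X \<and> \<eta> X = 0}"

lemma horizontal_vf: "X \<in> horizontal \<Longrightarrow> vf X"
  and horizontal_eta: "X \<in> horizontal \<Longrightarrow> \<eta> X = 0"
  by (simp_all add: horizontal_def)

lemma horizontal_phi: "X \<in> horizontal \<Longrightarrow> \<phi> X \<in> horizontal"
  and horizontal_shape: "X \<in> horizontal \<Longrightarrow> shape X \<in> horizontal"
  by (simp_all add: horizontal_def eta_phi eta_shape)

lemma horizontal_diff: "X \<in> horizontal \<Longrightarrow> Y \<in> horizontal \<Longrightarrow> X - Y \<in> horizontal"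
  by (simp add: horizontal_def eta_diff)

lemma horizontal_phi_phi: "X \<in> horizontal \<Longrightarrow> \<phi> (\<phi> X) = - X"
  by (simp add: horizontal_def phi_phi fscale_zero_left)

lemma horizontal_eqI:
  assumes "X \<in> horizontal" "\<And>Y. Y \<in> horizontal \<Longrightarrow> g X Y = 0"
  shows "X = 0"
  using g_self_eq_0[of X] assms horizontal_vf by blast

text \<open>This modification of the Levi-Civita connection by a skew-symmetric term makes \<open>\<xi>\<close> parallel. On
  horizontal fields it is the orthogonal projection of \<open>\<nabla>\<close> to \<open>ker \<eta>\<close>, hence the Levi-Civita
  connection of the leaves.\<close>

definition leaf :: "'a vfield \<Rightarrow> 'a vfield \<Rightarrow> 'a vfield" where
  "leaf X Y = nab X Y + \<eta> Y \<odot> shape X - g (shape X) Y \<odot> \<xi>"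

lemma vf_leaf [simp, intro]: "vf X \<Longrightarrow> vf Y \<Longrightarrow> vf (leaf X Y)"
  by (simp add: leaf_def)

lemma leaf_metric_connection: "metric_connection leaf"
  unfolding metric_connection_def
proof (intro conjI allI impI)
  fix X Y Z assume [simp]: "vf X" "vf Y" "vf Z"
  show "leaf X (Y - Z) = leaf X Y - leaf X Z"
    by (simp add: leaf_def nab_linear eta_linear g_linear fscale_diff_left algebra_simps)
  show "deriv_along X (g Y Z) = g (leaf X Y) Z + g Y (leaf X Z)"
    using g_sym[of Y "shape X"]
    by (simp add: leaf_def nab_metric g_linear g_xi_left g_xi_right algebra_simps)
next
  fix X Y assume [simp]: "vf X" "vf Y"
  show "leaf (- X) Y = - leaf X Y"
    by (simp add: leaf_def nab_linear shape_linear g_linear fscale_minus_left fscale_minus_right)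
qed simp

lemma leaf_xi: "vf X \<Longrightarrow> leaf X \<xi> = 0"
  by (simp add: leaf_def nab_xi eta_xi fscale_one g_xi_right eta_shape fscale_zero_left)

lemma eta_leaf: "vf X \<Longrightarrow> vf Y \<Longrightarrow> \<eta> (leaf X Y) = deriv_along X (\<eta> Y)"
  using connection_metric[OF leaf_metric_connection, of X Y \<xi>] by (simp add: leaf_xi g_xi_right g_0_right)

lemma leaf_minus: "vf X \<Longrightarrow> vf Y \<Longrightarrow> leaf X (- Y) = - leaf X Y"
  by (simp add: leaf_def nab_linear eta_linear g_linear fscale_minus_left)

lemma leaf_fscale:
  "vf X \<Longrightarrow> vf Y \<Longrightarrow> sf u \<Longrightarrow> leaf X (u \<odot> Y) = deriv_along X u \<odot> Y + u \<odot> leaf X Y"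
  by (simp add: leaf_def nab_linear eta_linear g_linear fscale_add_right fscale_diff_right fscale_fscale)

lemma horizontal_leaf: "vf X \<Longrightarrow> Y \<in> horizontal \<Longrightarrow> leaf X Y \<in> horizontal"
  by (simp add: horizontal_def eta_leaf deriv_along_0)

lemma leaf_torsion_free: "X \<in> horizontal \<Longrightarrow> Y \<in> horizontal \<Longrightarrow> leaf X Y - leaf Y X = lie_bracket X Y"
  using g_sym[of X "shape Y"] shape_symmetric[of X Y]
  by (simp add: leaf_def horizontal_def fscale_zero_left flip: torsion_free)

lemma horizontal_lie_bracket: "X \<in> horizontal \<Longrightarrow> Y \<in> horizontal \<Longrightarrow> lie_bracket X Y \<in> horizontal"
  using horizontal_leaf[of X Y] horizontal_leaf[of Y X]
  by (simp add: horizontal_def eta_diff flip: leaf_torsion_free)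

lemma gauss_equation:
  assumes "X \<in> horizontal" "Y \<in> horizontal" "Z \<in> horizontal" "W \<in> horizontal"
  shows "g (curvature leaf X Y Z) W =
    g (curvature nab X Y Z) W + g (shape Y) Z * g (shape X) W - g (shape X) Z * g (shape Y) W"
proof -
  have [simp]: "vf X" "vf Y" "vf Z" "vf W" "\<eta> W = 0" "\<eta> Z = 0"
    using assms by (simp_all add: horizontal_def)
  have second: "g (leaf U (leaf V Z)) W = g (nab U (nab V Z)) W + g (shape V) Z * g (shape U) W"
    if "U \<in> horizontal" "V \<in> horizontal" for U V
  proof -
    have [simp]: "vf U" "vf V" using that by (simp_all add: horizontal_def)
    have "g (leaf U (leaf V Z)) W = g (nab U (leaf V Z)) W"
      using horizontal_eta[OF horizontal_leaf[of V Z]] assms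
      by (simp add: leaf_def[of U "leaf V Z"] g_linear g_xi_left fscale_zero_left)
    also have "\<dots> = g (nab U (nab V Z)) W + g (shape V) Z * g (shape U) W"
      by (simp add: leaf_def[of V Z] nab_linear nab_xi g_linear g_xi_left fscale_zero_left)
    finally show ?thesis .
  qed
  have third: "g (leaf (lie_bracket X Y) Z) W = g (nab (lie_bracket X Y) Z) W"
    by (simp add: leaf_def g_linear g_xi_left)
  show ?thesis
    using second[OF assms(1,2)] second[OF assms(2,1)] third
    by (simp add: curvature_def g_linear algebra_simps)
qed

end

section \<open>Almost cosymplectic \<open>(\<kappa>,\<mu>,\<nu>)\<close>-spaces\<close>

locale almost_cosymplectic_kmn = almost_cosymplectic_manifold A g nab \<phi> \<xi> \<eta>
  for A :: "('a::{t2_space,second_countable_topology}, 'e::euclidean_space) atlas"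
    and g :: "'a vfield \<Rightarrow> 'a vfield \<Rightarrow> 'a \<Rightarrow> real"
    and nab :: "'a vfield \<Rightarrow> 'a vfield \<Rightarrow> 'a vfield"
    and \<phi> :: "'a vfield \<Rightarrow> 'a vfield"
    and \<xi> :: "'a vfield"
    and \<eta> :: "'a vfield \<Rightarrow> 'a \<Rightarrow> real" +
  fixes \<kappa> \<mu> \<nu> :: "'a \<Rightarrow> real"
  assumes kmn: "kappa_mu_nu_space A \<phi> \<xi> \<eta> g nab \<kappa> \<mu> \<nu>"
begin

lemma sf_kappa [simp, intro]: "sf \<kappa>" and sf_mu [simp, intro]: "sf \<mu>" and sf_nu [simp, intro]: "sf \<nu>"
  using kmn by (simp_all add: kappa_mu_nu_space_def)

lemma curvature_xi:
  assumes [simp]: "vf X" "vf Y"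
  shows "curvature nab X Y \<xi> = \<kappa> \<odot> (\<eta> Y \<odot> X - \<eta> X \<odot> Y)
    + \<mu> \<odot> (\<eta> X \<odot> \<phi> (shape Y) - \<eta> Y \<odot> \<phi> (shape X)) + \<nu> \<odot> (\<eta> Y \<odot> shape X - \<eta> X \<odot> shape Y)"
proof -
  have "curvature nab X Y \<xi> = \<kappa> \<odot> (\<eta> Y \<odot> X - \<eta> X \<odot> Y)
    + \<mu> \<odot> (\<eta> Y \<odot> h_tensor \<phi> \<xi> X - \<eta> X \<odot> h_tensor \<phi> \<xi> Y)
    + \<nu> \<odot> (\<eta> Y \<odot> \<phi> (h_tensor \<phi> \<xi> X) - \<eta> X \<odot> \<phi> (h_tensor \<phi> \<xi> Y))"
    using kmn by (simp add: kappa_mu_nu_space_def Let_def)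
  then show ?thesis
    by (simp add: h_tensor_eq phi_linear phi_phi_shape fscale_minus_right)
qed

lemma curvature_xi_horizontal:
  "X \<in> horizontal \<Longrightarrow> Y \<in> horizontal \<Longrightarrow> curvature nab X Y \<xi> = 0"
  by (simp add: curvature_xi horizontal_def fscale_zero_left fscale_zero_right)

text \<open>The definition of \<open>R(X,\<xi>)\<xi>\<close> gives \<open>\<nabla>\<^bsub>\<xi>\<^esub> A - A\<^sup>2\<close>, so the \<open>(\<kappa>,\<mu>,\<nu>)\<close>-condition reads
  \<open>\<nabla>\<^bsub>\<xi>\<^esub> A = S + \<mu> h + \<nu> A\<close> with \<open>S = A\<^sup>2 + \<kappa> (1 - \<eta> \<otimes> \<xi>)\<close>. Since \<open>\<nabla>\<^bsub>\<xi>\<^esub> \<phi> = 0\<close>, everything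
  except \<open>S\<close> anticommutes with \<open>\<phi>\<close>, while \<open>S\<close> commutes with it; so \<open>\<phi> S = 0\<close>.\<close>

lemma shape_shape:
  assumes [simp]: "vf X"
  shows "shape (shape X) = - (\<kappa> \<odot> (X - \<eta> X \<odot> \<xi>))"
proof -
  define S where "S V = shape (shape V) + \<kappa> \<odot> (V - \<eta> V \<odot> \<xi>)" for V
  have [simp]: "vf (S V)" if "vf V" for V using that by (simp add: S_def)
  let ?M = "cov_deriv11 nab shape \<xi>"
  have M: "?M V = S V - \<mu> \<odot> \<phi> (shape V) + \<nu> \<odot> shape V" if [simp]: "vf V" for V
  proof -
    have "curvature nab V \<xi> \<xi> = ?M V - shape (shape V)"
      by (simp add: curvature_def cov_deriv11_def nab_xi shape_xi nab_linear shape_linear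
          flip: torsion_free)
    moreover have "curvature nab V \<xi> \<xi> =
        \<kappa> \<odot> (V - \<eta> V \<odot> \<xi>) - \<mu> \<odot> \<phi> (shape V) + \<nu> \<odot> shape V"
      by (simp add: curvature_xi eta_xi shape_xi phi_0 fscale_one fscale_zero_right fscale_minus_right)
    ultimately show ?thesis
      by (simp add: S_def algebra_simps)
  qed
  have "?M (\<phi> X) + \<phi> (?M X) = 0"
    by (simp add: cov_deriv11_def phi_linear nab_xi_phi shape_phi nab_linear)
  moreover have "\<phi> (S X) = S (\<phi> X)"
    by (simp add: S_def phi_linear shape_phi shape_linear eta_phi phi_xi fscale_zero_left fscale_zero_right)
  ultimately have "\<phi> (S X) + \<phi> (S X) = 0"
    by (simp add: M phi_linear phi_phi_shape shape_phi shape_linear fscale_minus_right)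
  then have "\<phi> (S X) = 0"
    by (rule double_eq_0)
  then have "\<phi> (\<phi> (S X)) = 0"
    by (simp add: phi_0)
  moreover have "\<eta> (S X) = 0"
    by (simp add: S_def eta_linear eta_shape)
  ultimately have "S X = 0"
    by (simp add: phi_phi fscale_zero_left)
  then show ?thesis
    by (simp add: S_def eq_neg_iff_add_eq_0)
qed

lemma shape_shape_horizontal: "X \<in> horizontal \<Longrightarrow> shape (shape X) = - (\<kappa> \<odot> X)"
  by (simp add: horizontal_def shape_shape fscale_zero_left)

text \<open>This is \<open>R(X,Y)\<xi> = 0\<close>. Passing from \<open>\<nabla>\<close> to the leaf connection changes both sides by
  \<open>g(A X, A Y) \<xi>\<close>.\<close>

lemma codazzi:
  assumes "X \<in> horizontal" "Y \<in> horizontal"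
  shows "cov_deriv11 leaf shape X Y = cov_deriv11 leaf shape Y X"
proof -
  have [simp]: "vf X" "vf Y" "\<eta> X = 0" "\<eta> Y = 0"
    using assms by (simp_all add: horizontal_def)
  have "nab X (nab Y \<xi>) - nab Y (nab X \<xi>) - nab (lie_bracket X Y) \<xi> = 0"
    using curvature_xi_horizontal[OF assms] by (simp add: curvature_def)
  then have 1: "nab X (shape Y) - nab Y (shape X) - shape (lie_bracket X Y) = 0"
    by (simp add: nab_xi nab_linear algebra_simps)
  have "cov_deriv11 leaf shape X Y - cov_deriv11 leaf shape Y X
    = leaf X (shape Y) - leaf Y (shape X) - shape (leaf X Y - leaf Y X)"
    by (simp add: cov_deriv11_def shape_linear)
  also have "\<dots> = nab X (shape Y) - nab Y (shape X) - shape (lie_bracket X Y)"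
    using g_sym[of "shape X" "shape Y"]
    by (simp add: leaf_torsion_free[OF assms]) (simp add: leaf_def eta_shape fscale_zero_left)
  finally show ?thesis using 1 by simp
qed

text \<open>The leafwise derivative of \<open>A\<^sup>2 = - \<kappa>\<close>.\<close>

lemma cov_deriv_shape_anticommutator:
  assumes "X \<in> horizontal" "Y \<in> horizontal"
  shows "cov_deriv11 leaf shape X (shape Y) + shape (cov_deriv11 leaf shape X Y)
    = - (deriv_along X \<kappa> \<odot> Y)"
proof -
  have [simp]: "vf X" "vf Y"
    using assms by (simp_all add: horizontal_def)
  have "cov_deriv11 leaf shape X (shape Y) + shape (cov_deriv11 leaf shape X Y)
      = leaf X (shape (shape Y)) - shape (shape (leaf X Y))"
    by (simp add: cov_deriv11_def shape_linear)
  also have "\<dots> = - (deriv_along X \<kappa> \<odot> Y)"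
    using shape_shape_horizontal[OF assms(2)] shape_shape_horizontal[OF horizontal_leaf[of X Y]] assms
    by (simp add: leaf_minus leaf_fscale)
  finally show ?thesis .
qed

lemma horizontal_cov_deriv:
  assumes "X \<in> horizontal" "Y \<in> horizontal"
  shows "cov_deriv11 leaf shape X Y \<in> horizontal" "cov_deriv11 leaf \<phi> X Y \<in> horizontal"
  unfolding cov_deriv11_def
  by (intro horizontal_diff horizontal_leaf horizontal_shape horizontal_phi horizontal_vf assms)+

text \<open>The form \<open>b(X,Y,Z) = g((D\<^bsub>X\<^esub> A) Y, Z)\<close> is totally symmetric, by the Codazzi equation and the symmetry
  of \<open>A\<close>. So the derivative of \<open>A\<^sup>2 = - \<kappa>\<close> prescribes the three sums of two of the terms
  \<open>b(A X, Y, Z)\<close>, \<open>b(X, A Y, Z)\<close>, \<open>b(X, Y, A Z)\<close>, which determines each of them, as in the proof of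
  the Koszul formula.\<close>

lemma cov_deriv_shape_by_dkappa:
  assumes "X \<in> horizontal" "Y \<in> horizontal" "Z \<in> horizontal"
  shows "2 * g (cov_deriv11 leaf shape X Y) (shape Z) =
    deriv_along Z \<kappa> * g X Y - deriv_along X \<kappa> * g Y Z - deriv_along Y \<kappa> * g X Z"
proof
  fix p
  define b where "b U V W = g (cov_deriv11 leaf shape U V) W p" for U V W
  note hv [simp] = assms[THEN horizontal_vf] assms[THEN horizontal_vf, THEN vf_shape]
  have vc [simp]: "vf (cov_deriv11 leaf shape U V)" if "vf U" "vf V" for U V
    using that by (simp add: cov_deriv11_def)
  have sym1: "b U V W = b V U W" if "U \<in> horizontal" "V \<in> horizontal" for U V W
    using codazzi[OF that] by (simp add: b_def)
  have sym2: "b U V W = b U W V" if [simp]: "vf U" "vf V" "vf W" for U V W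
    using cov_deriv_symmetric[OF leaf_metric_connection, of shape U V W] g_sym[of V "cov_deriv11 leaf shape U W"]
    by (simp add: b_def shape_symmetric)
  have sq: "b U (shape V) W + b U V (shape W) = - deriv_along U \<kappa> p * g V W p"
    if UVW: "U \<in> horizontal" "V \<in> horizontal" "W \<in> horizontal" for U V W
  proof -
    have [simp]: "vf U" "vf V" "vf W" using that by (simp_all add: horizontal_def)
    have "g (cov_deriv11 leaf shape U (shape V)) W + g (cov_deriv11 leaf shape U V) (shape W)
      = g (cov_deriv11 leaf shape U (shape V) + shape (cov_deriv11 leaf shape U V)) W"
      by (simp add: g_linear shape_symmetric)
    also have "\<dots> = - deriv_along U \<kappa> * g V W"
      by (simp add: cov_deriv_shape_anticommutator[OF UVW(1,2)] g_linear)
    finally show ?thesis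
      by (simp add: b_def fun_eq_iff)
  qed
  note s = horizontal_shape[OF assms(1)] horizontal_shape[OF assms(2)] horizontal_shape[OF assms(3)]
  show "(2 * g (cov_deriv11 leaf shape X Y) (shape Z)) p =
    (deriv_along Z \<kappa> * g X Y - deriv_along X \<kappa> * g Y Z - deriv_along Y \<kappa> * g X Z) p"
    using sq[OF assms] sq[OF assms(2,1,3)] sq[OF assms(3,1,2)]
      sym1[OF assms(1,2), of "shape Z"] sym1[OF assms(2) s(1), of Z] sym1[OF assms(3) s(1), of Y]
      sym1[OF assms(3,1), of "shape Y"] sym2[of "shape X" Z Y] sym2[of X Z "shape Y"]
    by (simp add: b_def)
qed

text \<open>Replace \<open>Z\<close> by \<open>A Z\<close> in the formula for \<open>2 b(X, Y, A Z)\<close>: the left-hand side becomes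
  \<open>- 2 \<kappa> b(X, Y, Z)\<close>, which is symmetric in \<open>X\<close> and \<open>Z\<close>, so the right-hand side is symmetric too.\<close>

lemma dkappa_identity:
  assumes "X \<in> horizontal" "Z \<in> horizontal"
  shows "deriv_along (shape Z) \<kappa> \<odot> X - deriv_along X \<kappa> \<odot> shape Z =
    deriv_along (shape X) \<kappa> \<odot> Z - deriv_along Z \<kappa> \<odot> shape X"
proof -
  define U where "U = deriv_along (shape Z) \<kappa> \<odot> X - deriv_along X \<kappa> \<odot> shape Z -
    (deriv_along (shape X) \<kappa> \<odot> Z - deriv_along Z \<kappa> \<odot> shape X)"
  have [simp]: "vf X" "vf Z" "\<eta> X = 0" "\<eta> Z = 0"
    using assms by (simp_all add: horizontal_def)
  have U: "U \<in> horizontal"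
    by (simp add: horizontal_def U_def eta_linear eta_shape)
  have "U = 0"
  proof (rule horizontal_eqI[OF U])
    fix Y assume Y: "Y \<in> horizontal"
    then have [simp]: "vf Y" by (rule horizontal_vf)
    have vc [simp]: "vf (cov_deriv11 leaf shape U V)" if "vf U" "vf V" for U V
      using that by (simp add: cov_deriv11_def)
    have AA: "g (cov_deriv11 leaf shape V Y) (shape (shape W)) = - \<kappa> * g (cov_deriv11 leaf shape V Y) W"
      if "V \<in> horizontal" "W \<in> horizontal" for V W
      using that horizontal_vf by (simp add: shape_shape_horizontal g_linear)
    have "g (cov_deriv11 leaf shape X Y) Z = g (cov_deriv11 leaf shape Z Y) X"
      using codazzi[OF assms(1) Y] codazzi[OF assms(2) Y] g_sym[of X "cov_deriv11 leaf shape Y Z"]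
        cov_deriv_symmetric[OF leaf_metric_connection, of shape Y X Z]
      by (simp add: shape_symmetric)
    then have "2 * g (cov_deriv11 leaf shape X Y) (shape (shape Z)) =
        2 * g (cov_deriv11 leaf shape Z Y) (shape (shape X))"
      using AA assms by simp
    then show "g U Y = 0"
      using cov_deriv_shape_by_dkappa[OF assms(1) Y horizontal_shape[OF assms(2)]]
        cov_deriv_shape_by_dkappa[OF assms(2) Y horizontal_shape[OF assms(1)]]
        g_sym[of Y "shape Z"] g_sym[of Y "shape X"] g_sym[of Y Z] g_sym[of Y X] shape_symmetric[of X Z]
        g_sym[of "shape X" Z]
      by (simp add: U_def g_linear algebra_simps)
  qed
  then show ?thesis by (simp add: U_def)
qed

end

context almost_cosymplectic_kmn
begin

text \<open>Three linear conditions at \<open>p\<close> are imposed, the first being \<open>\<eta> X = 0\<close>. Subtracting the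
  \<open>\<xi>\<close>-component makes \<open>X\<close> horizontal everywhere and leaves its value at \<open>p\<close> unchanged.\<close>

lemma exists_horizontal_in_kernel:
  assumes dim: "DIM('e) \<ge> 5"
    and T: "\<And>X. vf X \<Longrightarrow> vf (T X)" "\<And>X Y. vf X \<Longrightarrow> vf Y \<Longrightarrow> T (X + Y) = T X + T Y"
      "\<And>X u. vf X \<Longrightarrow> sf u \<Longrightarrow> T (u \<odot> X) = u \<odot> T X" "T \<xi> = 0"
  obtains X where "X \<in> horizontal" "X p \<noteq> 0" "deriv_along X \<kappa> p = 0" "deriv_along (T X) \<kappa> p = 0"
proof -
  define l where "l i X = (if i = 0 then \<eta> X p else if i = 1 then deriv_along X \<kappa> p else deriv_along (T X) \<kappa> p)"
    for i :: nat and X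
  obtain X where X [simp]: "vf X" "X p \<noteq> 0" and lX: "\<And>i. i < 3 \<Longrightarrow> l i X = 0"
  proof (rule exists_field_in_kernel[of l 3 p])
    show "l i (X + Y) = l i X + l i Y" if "vf X" "vf Y" for i X Y
      using that by (simp add: l_def eta_linear deriv_along_add_field T)
    show "l i ((\<lambda>_. k) \<odot> X) = k * l i X" if "vf X" for i k X
      using that by (simp add: l_def eta_linear deriv_along_fscale T)
    show "3 < DIM('e)" using dim by simp
  qed blast
  have 0: "\<eta> X p = 0" "deriv_along X \<kappa> p = 0" "deriv_along (T X) \<kappa> p = 0"
    using lX[of 0] lX[of 1] lX[of 2] by (simp_all add: l_def)
  define Y where "Y = X + (- \<eta> X) \<odot> \<xi>"
  have "Y \<in> horizontal"
    by (simp add: Y_def horizontal_def eta_linear)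
  moreover have "Y p \<noteq> 0"
    using X(2) by (auto simp: Y_def fscale_def fun_eq_iff 0)
  moreover have "deriv_along Y \<kappa> p = 0"
    by (simp add: Y_def deriv_along_add_field deriv_along_fscale 0)
  moreover have "T Y = T X"
    by (simp add: Y_def T fscale_zero_right)
  ultimately show ?thesis
    using that 0 by simp
qed

text \<open>Write \<open>\<theta> = d\<kappa>\<close>. For \<open>U\<close> with \<open>\<theta>(U) = \<theta>(A U) = 0\<close> at \<open>p\<close>, \<open>dkappa_identity\<close> reads
  \<open>\<theta>(A V) U = - \<theta>(V) A U\<close>; a first such \<open>U\<close> shows \<open>\<theta> \<circ> A = m \<theta>\<close> at \<open>p\<close> for some number \<open>m\<close>.
  Hence \<open>\<theta>(X) = \<theta>(\<phi> X) = 0\<close> suffices for both \<open>X\<close> and \<open>\<phi> X\<close> to be admissible choices of \<open>U\<close>. As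
  \<open>g(A \<phi> X, \<phi> X) = - g(A X, X)\<close>, adding the two resulting equations, paired with \<open>X\<close> and \<open>\<phi> X\<close>, leaves
  \<open>2 \<theta>(A V) g(X, X) = 0\<close>. Going via \<open>m\<close> keeps the number of linear conditions at three; imposing
  \<open>\<theta> = \<theta> \<circ> A = \<theta> \<circ> \<phi> = \<theta> \<circ> A \<circ> \<phi> = 0\<close> at once would be too many in dimension five.\<close>

lemma dkappa_horizontal:
  assumes dim: "DIM('e) \<ge> 5" and neg: "\<And>p. \<kappa> p < 0" and Z: "Z \<in> horizontal"
  shows "deriv_along Z \<kappa> = 0"
proof
  fix p
  have pairing: "deriv_along (shape V) \<kappa> p * g U U p = - deriv_along V \<kappa> p * g (shape U) U p"
    if U: "U \<in> horizontal" "deriv_along U \<kappa> p = 0" "deriv_along (shape U) \<kappa> p = 0"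
      and V: "V \<in> horizontal" for U V
  proof -
    have [simp]: "vf U" "vf V" using U V by (simp_all add: horizontal_def)
    have "g (deriv_along (shape V) \<kappa> \<odot> U - deriv_along U \<kappa> \<odot> shape V) U p =
        g (deriv_along (shape U) \<kappa> \<odot> V - deriv_along V \<kappa> \<odot> shape U) U p"
      using dkappa_identity[OF U(1) V] by simp
    then show ?thesis
      by (simp add: g_linear U)
  qed
  obtain U where U: "U \<in> horizontal" "U p \<noteq> 0" "deriv_along U \<kappa> p = 0" "deriv_along (shape U) \<kappa> p = 0"
    using exists_horizontal_in_kernel[OF dim vf_shape shape_add shape_fscale shape_xi, of p] by blast
  define m where "m = - g (shape U) U p / g U U p"
  have eigen: "deriv_along (shape V) \<kappa> p = m * deriv_along V \<kappa> p" if "V \<in> horizontal" for V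
    using pairing[OF U(1,3,4) that] g_pos[OF horizontal_vf[OF U(1)] U(2)]
    by (simp add: m_def field_simps)
  obtain X where X: "X \<in> horizontal" "X p \<noteq> 0" "deriv_along X \<kappa> p = 0" "deriv_along (\<phi> X) \<kappa> p = 0"
    using exists_horizontal_in_kernel[OF dim vf_phi phi_add phi_fscale phi_xi, of p] by blast
  have [simp]: "vf X" "\<eta> X = 0" using X by (simp_all add: horizontal_def)
  have gX: "g X X p > 0" using g_pos X by simp
  have shape0: "deriv_along (shape V) \<kappa> p = 0" if V: "V \<in> horizontal" for V
  proof -
    have "deriv_along (shape V) \<kappa> p * g X X p = - deriv_along V \<kappa> p * g (shape X) X p"
      by (rule pairing) (use X eigen V in simp_all)
    moreover have "deriv_along (shape V) \<kappa> p * g (\<phi> X) (\<phi> X) p = - deriv_along V \<kappa> p * g (shape (\<phi> X)) (\<phi> X) p"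
      by (rule pairing) (use X eigen[OF horizontal_phi] horizontal_phi V in simp_all)
    moreover have "g (\<phi> X) (\<phi> X) p = g X X p"
      by (simp add: g_phi_phi)
    moreover have "g (shape (\<phi> X)) (\<phi> X) p = - g (shape X) X p"
      by (simp add: shape_phi g_linear g_phi_phi)
    ultimately have "deriv_along (shape V) \<kappa> p * g X X p = 0"
      by simp
    then show ?thesis using gX by simp
  qed
  have "deriv_along (shape (shape Z)) \<kappa> p = 0"
    using shape0 horizontal_shape[OF Z] by simp
  then have "\<kappa> p * deriv_along Z \<kappa> p = 0"
    using shape_shape_horizontal[OF Z] by (simp add: deriv_along_def fscale_def)
  then show "deriv_along Z \<kappa> p = 0 p"
    using neg[of p] by simp
qed

end

section \<open>Flatness of the leaves and the curvature tensor\<close>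

locale almost_cosymplectic_kmn_negative =
  almost_cosymplectic_kmn A g nab \<phi> \<xi> \<eta> \<kappa> \<mu> \<nu>
  for A :: "('a::{t2_space,second_countable_topology}, 'e::euclidean_space) atlas"
    and g :: "'a vfield \<Rightarrow> 'a vfield \<Rightarrow> 'a \<Rightarrow> real"
    and nab :: "'a vfield \<Rightarrow> 'a vfield \<Rightarrow> 'a vfield"
    and \<phi> :: "'a vfield \<Rightarrow> 'a vfield"
    and \<xi> :: "'a vfield"
    and \<eta> :: "'a vfield \<Rightarrow> 'a \<Rightarrow> real"
    and \<kappa> \<mu> \<nu> :: "'a \<Rightarrow> real" +
  assumes dim: "DIM('e) \<ge> 5"
    and kappa_neg: "\<And>p. \<kappa> p < 0"
begin

lemma shape_leaf_parallel:
  assumes "X \<in> horizontal" "Y \<in> horizontal"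
  shows "cov_deriv11 leaf shape X Y = 0"
proof (rule horizontal_eqI)
  show C: "cov_deriv11 leaf shape X Y \<in> horizontal"
    using assms by (rule horizontal_cov_deriv)
  fix Z assume Z: "Z \<in> horizontal"
  have [simp]: "vf Z" "vf (cov_deriv11 leaf shape X Y)"
    using Z C by (simp_all add: horizontal_def)
  have "2 * g (cov_deriv11 leaf shape X Y) (shape (shape Z)) = 0"
    using cov_deriv_shape_by_dkappa[OF assms horizontal_shape[OF Z]]
      dkappa_horizontal[OF dim kappa_neg] horizontal_shape[OF Z] assms by simp
  then have "\<kappa> p * g (cov_deriv11 leaf shape X Y) Z p = 0" for p
    by (simp add: shape_shape_horizontal[OF Z] g_linear fun_eq_iff)
  then show "g (cov_deriv11 leaf shape X Y) Z = 0"
    using kappa_neg by (simp add: fun_eq_iff less_imp_neq)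
qed

lemma leaf_shape: "X \<in> horizontal \<Longrightarrow> Y \<in> horizontal \<Longrightarrow> leaf X (shape Y) = shape (leaf X Y)"
  using shape_leaf_parallel[of X Y] by (simp add: cov_deriv11_def)

lemma phi_leaf_parallel:
  assumes "X \<in> horizontal" "Y \<in> horizontal"
  shows "cov_deriv11 leaf \<phi> X Y = 0"
proof (rule horizontal_eqI)
  let ?C = "cov_deriv11 leaf \<phi>"
  show "?C X Y \<in> horizontal"
    using assms by (rule horizontal_cov_deriv)
  fix Z assume Z: "Z \<in> horizontal"
  have hv [simp]: "vf V" if "V \<in> horizontal" for V using that by (rule horizontal_vf)
  have vC [simp]: "vf (?C V W)" if "V \<in> horizontal" "W \<in> horizontal" for V W
    using that by (simp add: cov_deriv11_def)
  note h [simp] = horizontal_phi horizontal_shape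
  have PC: "?C V (\<phi> W) = - \<phi> (?C V W)" if "V \<in> horizontal" "W \<in> horizontal" for V W
    using that horizontal_phi_phi[OF horizontal_leaf[of V W]]
    by (simp add: cov_deriv11_def horizontal_phi_phi leaf_minus phi_diff)
  have AC: "?C V (shape W) = - shape (?C V W)" if "V \<in> horizontal" "W \<in> horizontal" for V W
  proof -
    have "leaf V (\<phi> (shape W)) = - shape (leaf V (\<phi> W))"
      using leaf_shape[of V "\<phi> W"] that shape_phi[of W]
      by (metis h(1) hv leaf_minus minus_minus phi_minus vf_phi vf_shape)
    then show ?thesis
      using that by (simp add: cov_deriv11_def leaf_shape shape_diff shape_phi)
  qed
  show "g (?C X Y) Z = 0"
  proof
    fix p
    show "g (?C X Y) Z p = 0 p"
    proof (subst zero_fun_apply, rule kaehler_algebra[where H = horizontal and A = shape and P = \<phi> and k = "\<kappa> p"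
          and F = "\<lambda>X Y Z. g (?C X Y) Z p"])
      fix X Y Z assume XYZ [simp]: "X \<in> horizontal" "Y \<in> horizontal" "Z \<in> horizontal"
      have skew: "g (?C U V) W p = - g (?C U W) V p"
        if "U \<in> horizontal" "V \<in> horizontal" "W \<in> horizontal" for U V W
        using cov_deriv_skew[OF leaf_metric_connection, of \<phi> U V W] that by (simp add: phi_skew)
      show "g (?C X Z) Y p = - g (?C X Y) Z p"
        by (rule skew) simp_all
      have "ext_deriv2 (fundamental_form \<phi> g) X Y Z = 0"
        using cosymplectic by (simp add: almost_cosymplectic_def)
      then have "g (?C X Z) Y p + g (?C Y X) Z p + g (?C Z Y) X p = 0"
        by (subst (asm) ext_deriv2_cov_deriv[OF leaf_metric_connection])
           (simp_all add: phi_skew leaf_torsion_free fun_eq_iff)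
      then show "g (?C X Y) Z p + g (?C Y Z) X p + g (?C Z X) Y p = 0"
        using skew[of X Z Y] skew[of Y X Z] skew[of Z Y X] by simp
      show "g (?C X (shape Y)) Z p = - g (?C X Y) (shape Z) p"
        by (simp add: AC g_linear shape_symmetric)
      show "g (?C X (\<phi> Y)) Z p = g (?C X Y) (\<phi> Z) p"
        by (simp add: PC g_linear phi_skew)
      show "g (?C X Y) (shape (shape Z)) p = - \<kappa> p * g (?C X Y) Z p"
        by (simp add: shape_shape_horizontal g_linear)
      show "g (?C X Y) (\<phi> (\<phi> Z)) p = - g (?C X Y) Z p"
        by (simp add: horizontal_phi_phi g_linear)
      show "g (?C X Y) (shape (\<phi> Z)) p = - g (?C X Y) (\<phi> (shape Z)) p"
        by (simp add: shape_phi g_linear)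
    qed (use kappa_neg[of p] assms Z in auto)
  qed
qed

text \<open>The leaf connection satisfies the first Bianchi identity on horizontal fields, and its curvature
  commutes with the parallel operators \<open>A\<close> and \<open>\<phi>\<close>, so \<open>curvature_algebra_zero\<close> applies pointwise.\<close>

lemma leaf_flat:
  assumes "X \<in> horizontal" "Y \<in> horizontal" "Z \<in> horizontal" "W \<in> horizontal"
  shows "g (curvature leaf X Y Z) W = 0"
proof
  fix p
  let ?R = "curvature leaf"
  have hv [simp]: "vf V" if "V \<in> horizontal" for V using that by (rule horizontal_vf)
  note h [simp] = horizontal_phi horizontal_shape
  have vR [simp]: "vf (?R X Y Z)" if "X \<in> horizontal" "Y \<in> horizontal" "Z \<in> horizontal" for X Y Z
    using that by (intro vf_curvature[OF leaf_metric_connection]) simp_all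
  have sub: "horizontal \<subseteq> Collect vf" by auto
  note closed = horizontal_leaf[OF hv] horizontal_lie_bracket
  show "g (?R X Y Z) W p = 0 p"
  proof (subst zero_fun_apply, rule curvature_algebra_zero[where H = horizontal and A = shape and P = \<phi> and k = "\<kappa> p"
        and r = "\<lambda>X Y Z W. g (?R X Y Z) W p"])
    fix X Y Z W
    assume XYZW [simp]: "X \<in> horizontal" "Y \<in> horizontal" "Z \<in> horizontal" "W \<in> horizontal"
    show "g (?R Y X Z) W p = - g (?R X Y Z) W p"
      by (simp add: curvature_antisym[OF leaf_metric_connection, of X Y] g_linear)
    show "g (?R X Y W) Z p = - g (?R X Y Z) W p"
      by (simp add: curvature_skew[OF leaf_metric_connection, of X Y W])
    have "?R X Y Z + ?R Y Z X + ?R Z X Y = 0"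
      by (rule first_bianchi[OF leaf_metric_connection sub closed leaf_torsion_free]) simp_all
    then have "g (?R X Y Z + ?R Y Z X + ?R Z X Y) W p = 0"
      by (simp add: g_0_left)
    then show "g (?R X Y Z) W p + g (?R Y Z X) W p + g (?R Z X Y) W p = 0"
      by (simp add: g_linear)
    have "?R X Y (shape Z) = shape (?R X Y Z)"
      by (rule curvature_commutes[OF leaf_metric_connection sub closed horizontal_shape shape_diff
            shape_leaf_parallel]) simp_all
    then show "g (?R X Y (shape Z)) W p = g (?R X Y Z) (shape W) p"
      by (simp add: shape_symmetric)
    have "?R X Y (\<phi> Z) = \<phi> (?R X Y Z)"
      by (rule curvature_commutes[OF leaf_metric_connection sub closed horizontal_phi phi_diff
            phi_leaf_parallel]) simp_all
    then show "g (?R X Y (\<phi> Z)) W p = - g (?R X Y Z) (\<phi> W) p"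
      by (simp add: phi_skew)
    show "g (?R X Y Z) (shape (shape W)) p = - \<kappa> p * g (?R X Y Z) W p"
      by (simp add: shape_shape_horizontal g_linear)
    show "g (?R X Y Z) (\<phi> (\<phi> W)) p = - g (?R X Y Z) W p"
      by (simp add: horizontal_phi_phi g_linear)
    show "g (?R X Y Z) (shape (\<phi> W)) p = - g (?R X Y Z) (\<phi> (shape W)) p"
      by (simp add: shape_phi g_linear)
  qed (use kappa_neg[of p] assms in auto)
qed

definition hor :: "'a vfield \<Rightarrow> 'a vfield" where
  "hor X = X - \<eta> X \<odot> \<xi>"

lemma hor_horizontal [simp]: "vf X \<Longrightarrow> hor X \<in> horizontal"
  by (simp add: hor_def horizontal_def eta_linear)

lemma vf_hor [simp]: "vf X \<Longrightarrow> vf (hor X)"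
  by (simp add: hor_def)

lemma g_hor: "vf X \<Longrightarrow> vf Y \<Longrightarrow> g X Y = g X (hor Y) + \<eta> Y * g X \<xi>"
  by (simp add: hor_def g_linear)

text \<open>The last argument splits because \<open>g\<close> is linear, the third by skewness, and the first two by
  pair symmetry; for them the \<open>\<xi>\<close>-components drop out, since \<open>R(Z,W)\<xi> = 0\<close> for horizontal \<open>Z, W\<close>. Tensoriality of
  the curvature in its first three arguments follows in this way without computing with brackets.\<close>

lemma curvature_decomposition:
  assumes [simp]: "vf X" "vf Y" "vf Z" "vf W"
  shows "g (curvature nab X Y Z) W = g (curvature nab (hor X) (hor Y) (hor Z)) (hor W)
    + \<eta> Z * g (curvature nab X Y \<xi>) (hor W) - \<eta> W * g (curvature nab X Y \<xi>) Z"
proof -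
  let ?R = "\<lambda>X Y Z W. g (curvature nab X Y Z) W"
  have vR [simp]: "vf (curvature nab X Y Z)" if "vf X" "vf Y" "vf Z" for X Y Z
    using that by (rule vf_curvature[OF metric_connection_nab])
  have skew: "?R X Y Z W = - ?R X Y W Z" if "vf X" "vf Y" "vf Z" "vf W" for X Y Z W
    using that by (rule curvature_skew[OF metric_connection_nab])
  have slot4: "?R X Y Z W = ?R X Y Z (hor W) - \<eta> W * ?R X Y \<xi> Z"
    if [simp]: "vf X" "vf Y" "vf Z" "vf W" for X Y Z W
    using g_hor[of "curvature nab X Y Z" W] skew[of X Y Z \<xi>] by simp
  have slot3: "?R X Y Z (hor W) = ?R X Y (hor Z) (hor W) + \<eta> Z * ?R X Y \<xi> (hor W)"
    using slot4[of X Y "hor W" Z] skew[of X Y Z "hor W"] skew[of X Y "hor Z" "hor W"] by simp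
  have slot12: "?R (hor Z) (hor W) U V = ?R (hor Z) (hor W) (hor U) (hor V)" if [simp]: "vf U" "vf V" for U V
  proof -
    have 0: "curvature nab (hor Z) (hor W) \<xi> = 0"
      by (rule curvature_xi_horizontal) simp_all
    have 1: "?R (hor Z) (hor W) U V = ?R (hor Z) (hor W) U (hor V)"
      if [simp]: "vf U" "vf V" for U V
      using slot4[of "hor Z" "hor W" U V] by (simp add: 0 g_0_left)
    show ?thesis
      using 1[of U V] 1[of "hor V" U] skew[of "hor Z" "hor W" U "hor V"]
        skew[of "hor Z" "hor W" "hor U" "hor V"] by simp
  qed
  have "?R X Y (hor Z) (hor W) = ?R (hor X) (hor Y) (hor Z) (hor W)"
    using slot12[of X Y] curvature_pair_symmetry[of X Y "hor Z" "hor W"]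
      curvature_pair_symmetry[of "hor X" "hor Y" "hor Z" "hor W"] by simp
  then show ?thesis
    using slot4[of X Y Z W] slot3 by simp
qed

lemma shape_hor: "vf X \<Longrightarrow> shape (hor X) = shape X"
  by (simp add: hor_def shape_linear shape_xi fscale_zero_right)

lemma g_shape_hor: "vf X \<Longrightarrow> vf Y \<Longrightarrow> g (shape X) (hor Y) = g (shape X) Y"
  by (simp add: hor_def g_linear g_xi_right eta_shape)

theorem curvature_formula:
  assumes [simp]: "vf X" "vf Y" "vf Z"
  shows "curvature nab X Y Z =
    - (\<kappa> \<odot> R3 \<xi> \<eta> g X Y Z) - R52 \<phi> \<xi> g X Y Z - \<mu> \<odot> R6 \<phi> \<xi> \<eta> g X Y Z - \<nu> \<odot> R8 \<phi> \<xi> \<eta> g X Y Z"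
proof (rule g_eqI)
  let ?rhs = "- (\<kappa> \<odot> R3 \<xi> \<eta> g X Y Z) - R52 \<phi> \<xi> g X Y Z
    - \<mu> \<odot> R6 \<phi> \<xi> \<eta> g X Y Z - \<nu> \<odot> R8 \<phi> \<xi> \<eta> g X Y Z"
  show "vf (curvature nab X Y Z)"
    by (simp add: vf_curvature[OF metric_connection_nab])
  have h [simp]: "h_tensor \<phi> \<xi> V = - \<phi> (shape V)" "\<phi> (- \<phi> (shape V)) = shape V" if "vf V" for V
    using that by (simp_all add: h_tensor_eq phi_linear phi_phi_shape)
  show "vf ?rhs"
    by (simp add: R3_def R52_def R6_def R8_def Let_def)
  fix W assume [simp]: "vf W"
  have hor_part: "g (curvature nab (hor X) (hor Y) (hor Z)) (hor W) =
      g (shape X) Z * g (shape Y) W - g (shape Y) Z * g (shape X) W"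
    using gauss_equation[of "hor X" "hor Y" "hor Z" "hor W"] leaf_flat[of "hor X" "hor Y" "hor Z" "hor W"]
    by (simp add: shape_hor g_shape_hor algebra_simps)
  have \<eta>: "g U (hor V) = g U V - \<eta> U * \<eta> V" if "vf U" "vf V" for U V
    using that by (simp add: hor_def g_linear g_xi_right)
  show "g (curvature nab X Y Z) W = g ?rhs W"
    by (simp add: curvature_decomposition[of X Y Z W] hor_part curvature_xi R3_def R52_def R6_def R8_def Let_def
        g_linear eta_linear g_xi_left \<eta> eta_phi eta_shape algebra_simps)
qed

end

theorem corollary3p10:
  fixes A :: "('a::{t2_space,second_countable_topology}, 'e::euclidean_space) atlas"
    and \<phi> :: "'a vfield \<Rightarrow> 'a vfield"
    and \<xi> :: "'a vfield"
    and \<eta> :: "'a vfield \<Rightarrow> 'a \<Rightarrow> real"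
    and g :: "'a vfield \<Rightarrow> 'a vfield \<Rightarrow> 'a \<Rightarrow> real"
    and nab :: "'a vfield \<Rightarrow> 'a vfield \<Rightarrow> 'a vfield"
    and \<kappa> \<mu> \<nu> :: "'a \<Rightarrow> real"
  assumes "almost_cosymplectic A \<phi> \<xi> \<eta> g"
    and "levi_civita A g nab"
    and "kappa_mu_nu_space A \<phi> \<xi> \<eta> g nab \<kappa> \<mu> \<nu>"
    and "DIM('e) \<ge> 5"
    and "\<And>p. \<kappa> p < 0"
  shows "\<forall>X Y Z. vector_field A X \<longrightarrow> vector_field A Y \<longrightarrow> vector_field A Z \<longrightarrow>
    curvature nab X Y Z =
      - (\<kappa> \<odot> R3 \<xi> \<eta> g X Y Z) - R52 \<phi> \<xi> g X Y Z
      - \<mu> \<odot> R6 \<phi> \<xi> \<eta> g X Y Z - \<nu> \<odot> R8 \<phi> \<xi> \<eta> g X Y Z"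
proof -
  interpret almost_cosymplectic_kmn_negative A g nab \<phi> \<xi> \<eta> \<kappa> \<mu> \<nu>
    by unfold_locales
       (use assms in \<open>simp_all add: almost_cosymplectic_def almost_contact_metric_def\<close>)
  show ?thesis
    using curvature_formula by blast
qed

end
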